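(* Let $\Gamma$ be a group with identity $\epsilon$, let $R$ be a $\Gamma$-graded ring, let $A$ be a graded right $R$-module, let $S=\mathrm{END}_R(A)$, and let $S_\epsilon$ be the component of $S$ of degree $\epsilon$ (the ring of graded endomorphisms of $A$). Then the following conditions are equivalent. (1) $S_\epsilon$ is unit-regular. (2) $S_\epsilon$ is von Neumann regular and $A$ satisfies graded internal cancellation $\mathrm{IC}_{\mathrm{gr}}(A)$. (3) $S_\epsilon$ is von Neumann regular and, for all idempotents $e,f\in S_\epsilon$, $e\sim f$ implies $1-e\sim 1-f$. If $A$ is finitely generated, the equivalence of conditions (1), (2) and (3) holds with $S=\mathrm{End}_R(A)$.
   Context: Rings are associative and unital; modules are right modules; $\Gamma$ is an arbitrary (not necessarily abelian) group. For graded right $R$-modules $M,N$ and $\gamma\in\Gamma$, $\mathrm{Hom}_R(M,N)_\gamma=\{f\in\mathrm{Hom}_R(M,N) : f(M_\delta)\subseteq N_{\gamma\delta}\text{ for all }\delta\in\Gamma\}$, $\mathrm{HOM}_R(M,N)=\bigoplus_{\gamma\in\Gamma}\mathrm{Hom}_R(M,N)_\gamma\subseteq \mathrm{Hom}_R(M,N)$, and $\mathrm{END}_R(M)=\mathrm{HOM}_R(M,M)$, a $\Gamma$-graded ring; if $M$ is finitely generated, $\mathrm{END}_R(M)=\mathrm{End}_R(M)$. Graded homomorphisms are the elements of degree $\epsilon$; $\cong_{\mathrm{gr}}$ denotes graded isomorphism (a graded homomorphism that is bijective). A ring $T$ is von Neumann regular if for every $x\in T$ there is $y\in T$ with $xyx=x$,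 and unit-regular if for every $x\in T$ there is an invertible $u\in T$ with $xux=x$. For idempotents $e,f$ of a ring $T$ (here $T=S_\epsilon$), $e\sim f$ means that there are $x,y\in T$ with $xy=e$ and $yx=f$. $\mathrm{IC}_{\mathrm{gr}}(A)$: for all graded submodules $B,C,D,E$ of $A$ with $A=B\oplus C=D\oplus E$, $B\cong_{\mathrm{gr}}D$ implies $C\cong_{\mathrm{gr}}E$. *)

theory Defs
  imports "HOL-Algebra.AbelCoset"
begin

section \<open>Right modules\<close>

text \<open>As in HOL-Algebra's \<open>module\<close> record, only the additive part of the underlying
  \<open>ring\<close> record is meaningful; its multiplication and unit are ignored.\<close>

record ('r, 'm) right_module = "'m ring" +
  rsmult :: "['m, 'r] \<Rightarrow> 'm" (infixl \<open>\<star>\<index>\<close> 70)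

locale right_module = R: ring R + M: abelian_group M
  for R :: "('r, 'c) ring_scheme" and M :: "('r, 'm, 'd) right_module_scheme" +
  assumes rsmult_closed:
      "\<lbrakk>x \<in> carrier M; a \<in> carrier R\<rbrakk> \<Longrightarrow> x \<star>\<^bsub>M\<^esub> a \<in> carrier M"
    and rsmult_r_distr:
      "\<lbrakk>x \<in> carrier M; a \<in> carrier R; b \<in> carrier R\<rbrakk> \<Longrightarrow>
        x \<star>\<^bsub>M\<^esub> (a \<oplus>\<^bsub>R\<^esub> b) = x \<star>\<^bsub>M\<^esub> a \<oplus>\<^bsub>M\<^esub> x \<star>\<^bsub>M\<^esub> b"
    and rsmult_l_distr:
      "\<lbrakk>x \<in> carrier M; y \<in> carrier M; a \<in> carrier R\<rbrakk> \<Longrightarrow>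
        (x \<oplus>\<^bsub>M\<^esub> y) \<star>\<^bsub>M\<^esub> a = x \<star>\<^bsub>M\<^esub> a \<oplus>\<^bsub>M\<^esub> y \<star>\<^bsub>M\<^esub> a"
    and rsmult_assoc:
      "\<lbrakk>x \<in> carrier M; a \<in> carrier R; b \<in> carrier R\<rbrakk> \<Longrightarrow>
        x \<star>\<^bsub>M\<^esub> (a \<otimes>\<^bsub>R\<^esub> b) = (x \<star>\<^bsub>M\<^esub> a) \<star>\<^bsub>M\<^esub> b"
    and rsmult_one:
      "x \<in> carrier M \<Longrightarrow> x \<star>\<^bsub>M\<^esub> \<one>\<^bsub>R\<^esub> = x"

definition right_submodule ::
    "('r, 'c) ring_scheme \<Rightarrow> ('r, 'm, 'd) right_module_scheme \<Rightarrow> 'm set \<Rightarrow> bool" where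
  "right_submodule R M B \<longleftrightarrow>
     additive_subgroup B M \<and> (\<forall>x\<in>B. \<forall>a\<in>carrier R. x \<star>\<^bsub>M\<^esub> a \<in> B)"

definition fin_gen_module ::
    "('r, 'c) ring_scheme \<Rightarrow> ('r, 'm, 'd) right_module_scheme \<Rightarrow> bool" where
  "fin_gen_module R M \<longleftrightarrow>
     (\<exists>X. finite X \<and> X \<subseteq> carrier M \<and>
        (\<forall>m\<in>carrier M. \<exists>a \<in> X \<rightarrow> carrier R. m = (\<Oplus>\<^bsub>M\<^esub>x\<in>X. x \<star>\<^bsub>M\<^esub> a x)))"

text \<open>Homomorphisms are taken to be extensional, so that equality of homomorphisms is
  equality of functions.\<close>

definition Hom_mod ::
    "('r, 'c) ring_scheme \<Rightarrow> ('r, 'm, 'd) right_module_scheme \<Rightarrow>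
     ('r, 'n, 'e) right_module_scheme \<Rightarrow> ('m \<Rightarrow> 'n) set" where
  "Hom_mod R M N =
     {f \<in> carrier M \<rightarrow>\<^sub>E carrier N.
        (\<forall>x\<in>carrier M. \<forall>y\<in>carrier M. f (x \<oplus>\<^bsub>M\<^esub> y) = f x \<oplus>\<^bsub>N\<^esub> f y) \<and>
        (\<forall>x\<in>carrier M. \<forall>a\<in>carrier R. f (x \<star>\<^bsub>M\<^esub> a) = f x \<star>\<^bsub>N\<^esub> a)}"

definition End_ring ::
    "('r, 'c) ring_scheme \<Rightarrow> ('r, 'm, 'd) right_module_scheme \<Rightarrow> ('m \<Rightarrow> 'm) ring" where
  "End_ring R M =
     \<lparr>carrier = Hom_mod R M M,
      monoid.mult = (\<lambda>f g. compose (carrier M) f g),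
      one = (\<lambda>x\<in>carrier M. x),
      zero = (\<lambda>x\<in>carrier M. \<zero>\<^bsub>M\<^esub>),
      add = (\<lambda>f g. \<lambda>x\<in>carrier M. f x \<oplus>\<^bsub>M\<^esub> g x)\<rparr>"


section \<open>Gradings by a group\<close>

definition internal_direct_sum ::
    "'i set \<Rightarrow> ('a, 'c) ring_scheme \<Rightarrow> ('i \<Rightarrow> 'a set) \<Rightarrow> bool" where
  "internal_direct_sum I M D \<longleftrightarrow>
     (\<forall>i\<in>I. additive_subgroup (D i) M) \<and>
     (\<forall>x\<in>carrier M. \<exists>!d. d \<in> (\<Pi>\<^sub>E i\<in>I. D i) \<and> finite {i\<in>I. d i \<noteq> \<zero>\<^bsub>M\<^esub>} \<and>
        x = (\<Oplus>\<^bsub>M\<^esub>i\<in>{i\<in>I. d i \<noteq> \<zero>\<^bsub>M\<^esub>}. d i))"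

locale graded_ring = G: group G + R: ring R
  for G :: "('g, 'k) monoid_scheme" and R :: "('r, 'c) ring_scheme"
    and Rg :: "'g \<Rightarrow> 'r set" +
  assumes ring_decomp: "internal_direct_sum (carrier G) R Rg"
    and ring_mult_comp:
      "\<lbrakk>\<gamma> \<in> carrier G; \<delta> \<in> carrier G; a \<in> Rg \<gamma>; b \<in> Rg \<delta>\<rbrakk> \<Longrightarrow>
        a \<otimes>\<^bsub>R\<^esub> b \<in> Rg (\<gamma> \<otimes>\<^bsub>G\<^esub> \<delta>)"

locale graded_right_module = graded_ring G R Rg + right_module R M
  for G :: "('g, 'k) monoid_scheme" and R :: "('r, 'c) ring_scheme"
    and Rg :: "'g \<Rightarrow> 'r set" and M :: "('r, 'm, 'd) right_module_scheme"
    and Mg :: "'g \<Rightarrow> 'm set" +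
  assumes module_decomp: "internal_direct_sum (carrier G) M Mg"
    and rsmult_comp:
      "\<lbrakk>\<gamma> \<in> carrier G; \<delta> \<in> carrier G; x \<in> Mg \<gamma>; a \<in> Rg \<delta>\<rbrakk> \<Longrightarrow>
        x \<star>\<^bsub>M\<^esub> a \<in> Mg (\<gamma> \<otimes>\<^bsub>G\<^esub> \<delta>)"

definition Hom_deg ::
    "('g, 'k) monoid_scheme \<Rightarrow> ('r, 'c) ring_scheme \<Rightarrow>
     ('r, 'm, 'd) right_module_scheme \<Rightarrow> ('g \<Rightarrow> 'm set) \<Rightarrow>
     ('r, 'n, 'e) right_module_scheme \<Rightarrow> ('g \<Rightarrow> 'n set) \<Rightarrow> 'g \<Rightarrow> ('m \<Rightarrow> 'n) set" where
  "Hom_deg G R M Mg N Ng \<gamma> =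
     {f \<in> Hom_mod R M N. \<forall>\<delta>\<in>carrier G. f ` Mg \<delta> \<subseteq> Ng (\<gamma> \<otimes>\<^bsub>G\<^esub> \<delta>)}"

text \<open>The sum of the subgroups \<^term>\<open>Hom_deg G R M Mg N Ng \<gamma>\<close> inside
  \<^term>\<open>Hom_mod R M N\<close>; it is automatically direct.\<close>

definition HOM_gr ::
    "('g, 'k) monoid_scheme \<Rightarrow> ('r, 'c) ring_scheme \<Rightarrow>
     ('r, 'm, 'd) right_module_scheme \<Rightarrow> ('g \<Rightarrow> 'm set) \<Rightarrow>
     ('r, 'n, 'e) right_module_scheme \<Rightarrow> ('g \<Rightarrow> 'n set) \<Rightarrow> ('m \<Rightarrow> 'n) set" where
  "HOM_gr G R M Mg N Ng =
     {f \<in> Hom_mod R M N.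
        \<exists>F h. finite F \<and> F \<subseteq> carrier G \<and> (\<forall>\<gamma>\<in>F. h \<gamma> \<in> Hom_deg G R M Mg N Ng \<gamma>) \<and>
          (\<forall>x\<in>carrier M. f x = (\<Oplus>\<^bsub>N\<^esub>\<gamma>\<in>F. h \<gamma> x))}"

definition END_ring ::
    "('g, 'k) monoid_scheme \<Rightarrow> ('r, 'c) ring_scheme \<Rightarrow>
     ('r, 'm, 'd) right_module_scheme \<Rightarrow> ('g \<Rightarrow> 'm set) \<Rightarrow> ('m \<Rightarrow> 'm) ring" where
  "END_ring G R M Mg = (End_ring R M)\<lparr>carrier := HOM_gr G R M Mg M Mg\<rparr>"

text \<open>The component of degree \<open>\<epsilon>\<close> of a graded ring with components \<^term>\<open>Sg\<close>, as a ring.\<close>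

definition identity_component ::
    "('g, 'k) monoid_scheme \<Rightarrow> 's ring \<Rightarrow> ('g \<Rightarrow> 's set) \<Rightarrow> 's ring" where
  "identity_component G S Sg = S\<lparr>carrier := Sg \<one>\<^bsub>G\<^esub>\<rparr>"

definition graded_submodule ::
    "('g, 'k) monoid_scheme \<Rightarrow> ('r, 'c) ring_scheme \<Rightarrow>
     ('r, 'm, 'd) right_module_scheme \<Rightarrow> ('g \<Rightarrow> 'm set) \<Rightarrow> 'm set \<Rightarrow> bool" where
  "graded_submodule G R M Mg B \<longleftrightarrow>
     right_submodule R M B \<and>
     internal_direct_sum (carrier G) (M\<lparr>carrier := B\<rparr>) (\<lambda>\<gamma>. B \<inter> Mg \<gamma>)"

definition graded_isomorphic ::
    "('g, 'k) monoid_scheme \<Rightarrow> ('r, 'c) ring_scheme \<Rightarrow>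
     ('r, 'm, 'd) right_module_scheme \<Rightarrow> ('g \<Rightarrow> 'm set) \<Rightarrow>
     ('r, 'n, 'e) right_module_scheme \<Rightarrow> ('g \<Rightarrow> 'n set) \<Rightarrow> bool" where
  "graded_isomorphic G R M Mg N Ng \<longleftrightarrow>
     (\<exists>f \<in> Hom_deg G R M Mg N Ng \<one>\<^bsub>G\<^esub>. bij_betw f (carrier M) (carrier N))"

definition graded_isomorphic_sub ::
    "('g, 'k) monoid_scheme \<Rightarrow> ('r, 'c) ring_scheme \<Rightarrow>
     ('r, 'm, 'd) right_module_scheme \<Rightarrow> ('g \<Rightarrow> 'm set) \<Rightarrow> 'm set \<Rightarrow> 'm set \<Rightarrow> bool" where
  "graded_isomorphic_sub G R M Mg B D \<longleftrightarrow>
     graded_isomorphic G R (M\<lparr>carrier := B\<rparr>) (\<lambda>\<gamma>. B \<inter> Mg \<gamma>) (M\<lparr>carrier := D\<rparr>) (\<lambda>\<gamma>. D \<inter> Mg \<gamma>)"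

definition is_direct_sum2 ::
    "('a, 'c) ring_scheme \<Rightarrow> 'a set \<Rightarrow> 'a set \<Rightarrow> bool" where
  "is_direct_sum2 M B C \<longleftrightarrow> carrier M = B <+>\<^bsub>M\<^esub> C \<and> B \<inter> C = {\<zero>\<^bsub>M\<^esub>}"

definition IC_gr ::
    "('g, 'k) monoid_scheme \<Rightarrow> ('r, 'c) ring_scheme \<Rightarrow>
     ('r, 'm, 'd) right_module_scheme \<Rightarrow> ('g \<Rightarrow> 'm set) \<Rightarrow> bool" where
  "IC_gr G R A Ag \<longleftrightarrow>
     (\<forall>B C D E.
        graded_submodule G R A Ag B \<longrightarrow> graded_submodule G R A Ag C \<longrightarrow>
        graded_submodule G R A Ag D \<longrightarrow> graded_submodule G R A Ag E \<longrightarrow>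
        is_direct_sum2 A B C \<longrightarrow> is_direct_sum2 A D E \<longrightarrow>
        graded_isomorphic_sub G R A Ag B D \<longrightarrow> graded_isomorphic_sub G R A Ag C E)"


section \<open>Regularity conditions on rings\<close>

definition von_neumann_regular :: "('s, 'c) ring_scheme \<Rightarrow> bool" where
  "von_neumann_regular T \<longleftrightarrow>
     (\<forall>x\<in>carrier T. \<exists>y\<in>carrier T. x \<otimes>\<^bsub>T\<^esub> y \<otimes>\<^bsub>T\<^esub> x = x)"

definition unit_regular :: "('s, 'c) ring_scheme \<Rightarrow> bool" where
  "unit_regular T \<longleftrightarrow>
     (\<forall>x\<in>carrier T. \<exists>u\<in>Units T. x \<otimes>\<^bsub>T\<^esub> u \<otimes>\<^bsub>T\<^esub> x = x)"

definition idempotents :: "('s, 'c) ring_scheme \<Rightarrow> 's set" where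
  "idempotents T = {e \<in> carrier T. e \<otimes>\<^bsub>T\<^esub> e = e}"

definition idem_equiv :: "('s, 'c) ring_scheme \<Rightarrow> 's \<Rightarrow> 's \<Rightarrow> bool" where
  "idem_equiv T e f \<longleftrightarrow>
     (\<exists>x\<in>carrier T. \<exists>y\<in>carrier T. x \<otimes>\<^bsub>T\<^esub> y = e \<and> y \<otimes>\<^bsub>T\<^esub> x = f)"

end

theory Submission
  imports Defs "HOL-Algebra.Subrings"
begin

text \<open>Idempotents of \<open>S\<^sub>\<epsilon>\<close> correspond to graded decompositions \<open>A = eA \<oplus> (1 - e)A\<close>, and \<open>e \<sim> f\<close> holds
  iff \<open>eA\<close> and \<open>fA\<close> are isomorphic as graded modules. Hence graded internal cancellation of \<open>A\<close> is
  exactly the condition that \<open>e \<sim> f\<close> implies \<open>1 - e \<sim> 1 - f\<close> in \<open>S\<^sub>\<epsilon>\<close>, and the rest is a statement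
  about an arbitrary ring. An endomorphism \<open>f\<close> of a graded module has homogeneous parts \<open>f\<^sub>\<gamma>\<close>, which
  at each element vanish for all but finitely many \<open>\<gamma>\<close> and sum up to \<open>f\<close>; on a finitely generated
  module only finitely many \<open>f\<^sub>\<gamma>\<close> are nonzero, whence \<open>END(A) = End(A)\<close>.\<close>

section \<open>Unit-regular rings and equivalence of idempotents\<close>

text \<open>Witnesses \<open>x\<close>, \<open>y\<close> of \<open>e \<sim> f\<close> need have no
  further relation to \<open>e\<close> and \<open>f\<close>. Replacing them by \<open>e x\<close>
  and \<open>f y\<close> puts them into the corners \<open>eSf\<close> and \<open>fSe\<close>; this
  form makes the relation transitive, makes cross terms vanish in the construction of a unit, and
  lets \<open>y\<close> restrict to a map from \<open>eA\<close> onto \<open>fA\<close>. Gradings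
  are handled through the component maps of an internal direct sum: a graded submodule is one closed
  under components, and a graded endomorphism commutes with them. This is why the projection
  belonging to a graded decomposition is itself graded. The group may be nonabelian, so sides
  matter: endomorphisms shift degrees on the left and scalars on the right, and these shifts commute
  by associativity. Hence the homogeneous parts of an endomorphism are again linear. The ring
  \<open>S_\<epsilon>\<close> is the same whether cut out of \<open>END\<close> or of
  \<open>End\<close>. The finitely generated case therefore only asks for one finite set of degrees
  serving all elements at once, and the generators supply it.\<close>

context ring
begin

text \<open>The hypothesis places \<open>p\<close> in the right ideal \<open>eR\<close>. If also
  \<open>p e = e\<close>, the complements \<open>1 - e\<close> and \<open>1 - p\<close> are
  themselves witnesses of \<open>1 - e \<sim> 1 - p\<close>. The case \<open>p = e\<close> says that
  the complement of an idempotent is idempotent.\<close>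

lemma compl_mult_compl_left:
  assumes "e \<in> carrier R" "p \<in> carrier R" "e \<otimes> p = p"
  shows "(\<one> \<ominus> e) \<otimes> p = \<zero>" "(\<one> \<ominus> e) \<otimes> (\<one> \<ominus> p) = \<one> \<ominus> e"
proof -
  show *: "(\<one> \<ominus> e) \<otimes> p = \<zero>"
    using assms by (simp add: minus_eq l_distr l_minus r_neg)
  show "(\<one> \<ominus> e) \<otimes> (\<one> \<ominus> p) = \<one> \<ominus> e"
    using assms(1,2) * by (simp add: minus_eq r_distr r_minus)
qed

text \<open>The mirror image, for idempotents that generate the same left ideal.\<close>

lemma compl_mult_compl_right:
  assumes "e \<in> carrier R" "p \<in> carrier R" "p \<otimes> e = p"
  shows "p \<otimes> (\<one> \<ominus> e) = \<zero>" "(\<one> \<ominus> p) \<otimes> (\<one> \<ominus> e) = \<one> \<ominus> e"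
proof -
  show *: "p \<otimes> (\<one> \<ominus> e) = \<zero>"
    using assms by (simp add: minus_eq r_distr r_minus r_neg)
  have "(\<one> \<ominus> p) \<otimes> (\<one> \<ominus> e) = (\<one> \<ominus> e) \<ominus> p \<otimes> (\<one> \<ominus> e)"
    using assms(1,2) by (simp add: minus_eq l_distr l_minus)
  then show "(\<one> \<ominus> p) \<otimes> (\<one> \<ominus> e) = \<one> \<ominus> e"
    unfolding * using assms(1) by (simp add: minus_eq)
qed

lemma add_compl:
  assumes "e \<in> carrier R"
  shows "e \<oplus> (\<one> \<ominus> e) = \<one>"
  using assms a_lcomm[of e \<one> "\<ominus> e"] by (simp add: minus_eq r_neg)

lemma compl_idempotent:
  assumes "e \<in> idempotents R"
  shows "\<one> \<ominus> e \<in> idempotents R"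
  using assms compl_mult_compl_left(2)[of e e] by (auto simp: idempotents_def)

text \<open>Both \<open>e x\<close> and \<open>x f\<close> equal \<open>x y x\<close>, and both
  \<open>f y\<close> and \<open>y e\<close> equal \<open>y x y\<close>. So passing to
  \<open>e x\<close> and \<open>f y\<close> keeps the products, by idempotency, and makes the
  witnesses absorb \<open>e\<close> and \<open>f\<close> on the proper sides.\<close>

lemma idem_equiv_corner:
  assumes "idem_equiv R e f" "e \<in> idempotents R" "f \<in> idempotents R"
  obtains x y where "x \<in> carrier R" "y \<in> carrier R" "x \<otimes> y = e" "y \<otimes> x = f"
    "e \<otimes> x = x" "x \<otimes> f = x" "f \<otimes> y = y" "y \<otimes> e = y"
proof -
  obtain x y where xy: "x \<in> carrier R" "y \<in> carrier R" "x \<otimes> y = e" "y \<otimes> x = f"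
    using assms by (auto simp: idem_equiv_def)
  have e: "e \<in> carrier R" "e \<otimes> e = e" and f: "f \<in> carrier R" "f \<otimes> f = f"
    using assms by (auto simp: idempotents_def)
  have ex: "e \<otimes> x = x \<otimes> f" and fy: "f \<otimes> y = y \<otimes> e"
    using xy by (auto simp: m_assoc)
  show thesis
  proof (rule that)
    show "(e \<otimes> x) \<otimes> (f \<otimes> y) = e"
      using xy e f ex fy by (metis m_assoc m_closed)
    show "(f \<otimes> y) \<otimes> (e \<otimes> x) = f"
      using xy e f ex fy by (metis m_assoc m_closed)
    show "e \<otimes> (e \<otimes> x) = e \<otimes> x" "f \<otimes> (f \<otimes> y) = f \<otimes> y"
      using xy e f by (simp_all flip: m_assoc)
    show "(e \<otimes> x) \<otimes> f = e \<otimes> x" "(f \<otimes> y) \<otimes> e = f \<otimes> y"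
      using xy e f ex fy by (simp_all add: m_assoc)
  qed (use xy e f in auto)
qed

text \<open>Multiplying the witnesses leaves a copy of the middle idempotent \<open>f\<close> inside
  each product; the corner form absorbs it.\<close>

lemma idem_equiv_trans:
  assumes "idem_equiv R e f" "idem_equiv R f g"
    and "e \<in> idempotents R" "f \<in> idempotents R" "g \<in> idempotents R"
  shows "idem_equiv R e g"
proof -
  obtain x y where xy: "x \<in> carrier R" "y \<in> carrier R" "x \<otimes> y = e" "y \<otimes> x = f"
    "f \<otimes> y = y"
    using idem_equiv_corner[OF assms(1,3,4)] by metis
  obtain z w where zw: "z \<in> carrier R" "w \<in> carrier R" "z \<otimes> w = f" "w \<otimes> z = g"
    "f \<otimes> z = z"
    using idem_equiv_corner[OF assms(2,4,5)] by metis
  have "(x \<otimes> z) \<otimes> (w \<otimes> y) = x \<otimes> ((z \<otimes> w) \<otimes> y)"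
    using xy(1,2) zw(1,2) by (simp add: m_assoc)
  moreover have "(w \<otimes> y) \<otimes> (x \<otimes> z) = w \<otimes> ((y \<otimes> x) \<otimes> z)"
    using xy(1,2) zw(1,2) by (simp add: m_assoc)
  ultimately show ?thesis
    unfolding idem_equiv_def using xy zw by (metis m_closed)
qed

lemma unit_regular_imp_regular: "unit_regular R \<Longrightarrow> von_neumann_regular R"
  unfolding unit_regular_def von_neumann_regular_def Units_def by fast

text \<open>If \<open>x u x = x\<close> with \<open>u\<close> a unit, then the idempotents \<open>x u\<close> and \<open>u x\<close> are conjugate, hence so are
  their complements; moreover \<open>x u\<close> generates the same right ideal as \<open>e\<close>, and \<open>u x\<close> the same left
  ideal as \<open>f\<close>.\<close>

lemma unit_regular_imp_compl_equiv:
  assumes "unit_regular R" "idem_equiv R e f" "e \<in> idempotents R" "f \<in> idempotents R"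
  shows "idem_equiv R (\<one> \<ominus> e) (\<one> \<ominus> f)"
proof -
  obtain x y where xy: "x \<in> carrier R" "y \<in> carrier R" "x \<otimes> y = e" "y \<otimes> x = f"
    "e \<otimes> x = x" "x \<otimes> f = x"
    using idem_equiv_corner[OF assms(2-4)] by metis
  have e: "e \<in> carrier R" and f: "f \<in> carrier R"
    using assms by (auto simp: idempotents_def)
  obtain u where u: "u \<in> Units R" "x \<otimes> u \<otimes> x = x"
    using assms(1) xy(1) by (auto simp: unit_regular_def)
  note uc = Units_closed[OF u(1)] Units_inv_closed[OF u(1)]
  define p where "p = x \<otimes> u"
  define q where "q = u \<otimes> x"
  have pq: "p \<in> carrier R" "q \<in> carrier R"
    using xy uc by (auto simp: p_def q_def)
  have pp: "p \<otimes> p = p" and qq: "q \<otimes> q = q"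
    using u(2) xy(1) uc by (metis p_def q_def m_assoc m_closed)+
  have ep: "e \<otimes> p = p"
    using xy e uc by (simp add: p_def flip: m_assoc)
  \<comment> \<open>Here \<open>p e = x u x y\<close>, which \<open>x u x = x\<close> collapses to
    \<open>x y\<close>.\<close>
  have pe: "p \<otimes> e = e"
    using xy uc u by (metis p_def m_assoc m_closed)
  have qf: "q \<otimes> f = q"
    using xy f uc by (simp add: q_def m_assoc)
  have fq: "f \<otimes> q = f"
    using xy uc u by (metis q_def m_assoc m_closed)
  have conj: "u \<otimes> (\<one> \<ominus> p) \<otimes> inv u = \<one> \<ominus> q"
    using xy uc u(1)
    by (simp add: p_def q_def minus_eq l_distr r_distr l_minus r_minus m_assoc)
  \<comment> \<open>Conjugate idempotents are equivalent: \<open>(1 - p) inv u\<close> and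
    \<open>u (1 - p)\<close> are the witnesses, and their two products are computed here.\<close>
  have "(\<one> \<ominus> p) \<otimes> inv u \<otimes> (u \<otimes> (\<one> \<ominus> p)) = (\<one> \<ominus> p) \<otimes> ((inv u \<otimes> u) \<otimes> (\<one> \<ominus> p))"
    using pq uc by (simp add: m_assoc del: Units_l_inv)
  also have "\<dots> = \<one> \<ominus> p"
    using pq pp u compl_mult_compl_left[of p p] by simp
  finally have 1: "(\<one> \<ominus> p) \<otimes> inv u \<otimes> (u \<otimes> (\<one> \<ominus> p)) = \<one> \<ominus> p" .
  have "u \<otimes> (\<one> \<ominus> p) \<otimes> ((\<one> \<ominus> p) \<otimes> inv u) = u \<otimes> ((\<one> \<ominus> p) \<otimes> (\<one> \<ominus> p)) \<otimes> inv u"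
    using pq uc by (simp add: m_assoc)
  also have "\<dots> = \<one> \<ominus> q"
    using pq pp conj compl_mult_compl_left[of p p] by simp
  finally have 2: "u \<otimes> (\<one> \<ominus> p) \<otimes> ((\<one> \<ominus> p) \<otimes> inv u) = \<one> \<ominus> q" .
  have pqi: "p \<in> idempotents R" "q \<in> idempotents R"
    using pq pp qq by (auto simp: idempotents_def)
  have "idem_equiv R (\<one> \<ominus> p) (\<one> \<ominus> q)"
    unfolding idem_equiv_def
    by (intro bexI[of _ "(\<one> \<ominus> p) \<otimes> inv u"] bexI[of _ "u \<otimes> (\<one> \<ominus> p)"] conjI 1 2)
      (use pq uc in auto)
  moreover have "idem_equiv R (\<one> \<ominus> e) (\<one> \<ominus> p)"
    unfolding idem_equiv_def using e pq ep pe
    by (intro bexI[of _ "\<one> \<ominus> e"] bexI[of _ "\<one> \<ominus> p"] conjI compl_mult_compl_left(2)) auto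
  moreover have "idem_equiv R (\<one> \<ominus> q) (\<one> \<ominus> f)"
    unfolding idem_equiv_def using f pq qf fq
    by (intro bexI[of _ "\<one> \<ominus> f"] bexI[of _ "\<one> \<ominus> q"] conjI compl_mult_compl_right(2)) auto
  ultimately show ?thesis
    by (meson idem_equiv_trans compl_idempotent assms(3,4) pqi)
qed

text \<open>If \<open>x y x = x\<close> and \<open>y x y = y\<close>, a unit quasi-inverse of \<open>x\<close> arises by adding to \<open>y\<close> an
  equivalence between the complements of \<open>x y\<close> and \<open>y x\<close>.\<close>

lemma regular_compl_equiv_imp_unit_regular:
  assumes "von_neumann_regular R"
    and compl: "\<And>e f. \<lbrakk>e \<in> idempotents R; f \<in> idempotents R; idem_equiv R e f\<rbrakk> \<Longrightarrow>
      idem_equiv R (\<one> \<ominus> e) (\<one> \<ominus> f)"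
  shows "unit_regular R"
  unfolding unit_regular_def
proof
  fix x assume x: "x \<in> carrier R"
  obtain z where z: "z \<in> carrier R" "x \<otimes> z \<otimes> x = x"
    using assms(1) x by (auto simp: von_neumann_regular_def)
  \<comment> \<open>Passing from \<open>z\<close> to \<open>z x z\<close> adds the relation
    \<open>y x y = y\<close>, which is what kills the cross terms \<open>y a\<close> and
    \<open>a y\<close> below.\<close>
  define y where "y = z \<otimes> x \<otimes> z"
  have y: "y \<in> carrier R"
    using x z by (simp add: y_def)
  have xyx: "x \<otimes> y \<otimes> x = x" and yxy: "y \<otimes> x \<otimes> y = y"
    using x z by (metis y_def m_assoc m_closed)+
  define e f where "e = x \<otimes> y" and "f = y \<otimes> x"
  have e: "e \<in> carrier R" "e \<in> idempotents R" and f: "f \<in> carrier R" "f \<in> idempotents R"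
    using x y xyx yxy by (auto simp: e_def f_def idempotents_def simp flip: m_assoc)
  have "idem_equiv R e f"
    unfolding idem_equiv_def using x y e_def f_def by blast
  then have "idem_equiv R (\<one> \<ominus> e) (\<one> \<ominus> f)"
    using compl e f by blast
  then obtain a b where ab: "a \<in> carrier R" "b \<in> carrier R"
      "a \<otimes> b = \<one> \<ominus> e" "b \<otimes> a = \<one> \<ominus> f"
      "(\<one> \<ominus> e) \<otimes> a = a" "(\<one> \<ominus> f) \<otimes> b = b" "a \<otimes> (\<one> \<ominus> f) = a" "b \<otimes> (\<one> \<ominus> e) = b"
    using idem_equiv_corner compl_idempotent e f by metis
  have ann: "g \<otimes> (\<one> \<ominus> g) = \<zero>" "(\<one> \<ominus> g) \<otimes> g = \<zero>" if "g \<in> idempotents R" for g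
    using that by (auto simp: idempotents_def compl_mult_compl_left compl_mult_compl_right)
  \<comment> \<open>Each of the four mixed products can be rewritten with a factor
    \<open>g (1 - g)\<close> or \<open>(1 - g) g\<close>, where \<open>g\<close> is \<open>e\<close>
    or \<open>f\<close>; for instance \<open>y a = y e (1 - e) a\<close>.\<close>
  have "y \<otimes> a = \<zero>"
    using ann(1)[OF e(2)] ab yxy x y e
    by (metis e_def m_assoc minus_closed one_closed r_null l_null)
  moreover have "b \<otimes> x = \<zero>"
    using ann(2)[OF e(2)] ab xyx x y e
    by (metis e_def m_assoc minus_closed one_closed r_null l_null)
  moreover have "x \<otimes> b = \<zero>"
    using ann(1)[OF f(2)] ab xyx x y f
    by (metis f_def m_assoc minus_closed one_closed r_null l_null)
  moreover have "a \<otimes> y = \<zero>"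
    using ann(2)[OF f(2)] ab yxy x y f
    by (metis f_def m_assoc minus_closed one_closed r_null l_null)
  \<comment> \<open>What remains are sums of complementary idempotents, so \<open>x + a\<close> is a
    two-sided inverse of \<open>y + b\<close>. Because \<open>x b = 0\<close>, the summand
    \<open>b\<close> does not disturb \<open>x y x = x\<close>.\<close>
  ultimately have "(y \<oplus> b) \<otimes> (x \<oplus> a) = f \<oplus> (\<one> \<ominus> f)" "(x \<oplus> a) \<otimes> (y \<oplus> b) = e \<oplus> (\<one> \<ominus> e)"
    and xbx: "x \<otimes> (y \<oplus> b) \<otimes> x = x"
    using x y ab(1,2) e(1) f(1) xyx by (simp_all add: l_distr r_distr ab(3,4) e_def f_def)
  note this add_compl[OF e(1)] add_compl[OF f(1)]
  then have "y \<oplus> b \<in> Units R"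
    using x y ab(1,2) e(1) f(1) by (auto simp: Units_def intro!: bexI[of _ "x \<oplus> a"])
  with xbx show "\<exists>u\<in>Units R. x \<otimes> u \<otimes> x = x"
    by blast
qed

theorem unit_regular_iff_compl_equiv:
  "unit_regular R \<longleftrightarrow> von_neumann_regular R \<and>
     (\<forall>e\<in>idempotents R. \<forall>f\<in>idempotents R.
        idem_equiv R e f \<longrightarrow> idem_equiv R (\<one> \<ominus> e) (\<one> \<ominus> f))"
  using unit_regular_imp_regular unit_regular_imp_compl_equiv regular_compl_equiv_imp_unit_regular
  by blast

end

section \<open>Homogeneous components\<close>

lemma (in abelian_group) abelian_group_subgroup:
  assumes "additive_subgroup B G"
  shows "abelian_group (G\<lparr>carrier := B\<rparr>)"
proof -
  have B: "subgroup B (add_monoid G)"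
    using assms by (simp add: additive_subgroup_def)
  have "group (add_monoid G\<lparr>carrier := B\<rparr>)"
    using add.subgroup_imp_group[OF B] .
  then have "comm_group (add_monoid (G\<lparr>carrier := B\<rparr>))"
    by (intro group.group_comm_groupI)
      (use subgroup.subset[OF B] in \<open>auto intro: a_comm\<close>)
  then show ?thesis
    by (simp add: abelian_group_def abelian_group_axioms_def abelian_monoid_def comm_group_def)
qed

text \<open>\<open>finsum\<close> takes the whole record, carrier included, so a decomposition
  inside a submodule is formally a different sum from the one in the ambient module. This lemma
  translates between them.\<close>

lemma (in abelian_group) finsum_subgroup:
  assumes "additive_subgroup B G" "finite J" "\<And>j. j \<in> J \<Longrightarrow> f j \<in> B"
  shows "finsum (G\<lparr>carrier := B\<rparr>) f J = finsum G f J" "finsum G f J \<in> B"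
proof -
  interpret B: abelian_group "G\<lparr>carrier := B\<rparr>"
    using abelian_group_subgroup[OF assms(1)] .
  interpret BB: additive_subgroup B G by fact
  have "B \<subseteq> carrier G"
    by (rule BB.a_subset)
  have "finsum (G\<lparr>carrier := B\<rparr>) f J = finsum G f J \<and> finsum G f J \<in> B"
    using assms(2,3)
  proof (induction J)
    case (insert j J)
    then show ?case
      using \<open>B \<subseteq> carrier G\<close>
      by (subst B.finsum_insert; (subst finsum_insert)?) auto
  qed auto
  then show "finsum (G\<lparr>carrier := B\<rparr>) f J = finsum G f J" "finsum G f J \<in> B"
    by auto
qed

text \<open>Only the additive structure and an index set enter, so that the same theory of
  components applies to the module and to the ring of scalars.\<close>

locale direct_sum_decomp = abelian_group M
  for I :: "'i set" and M :: "('a, 'c) ring_scheme" and D :: "'i \<Rightarrow> 'a set" +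
  assumes decomp: "internal_direct_sum I M D"
begin

text \<open>Uniqueness is available for the whole family only, so the family is described first and
  then evaluated at \<open>i\<close>. With the index as first argument, \<open>component i\<close>
  is the projection.\<close>

definition component :: "'i \<Rightarrow> 'a \<Rightarrow> 'a" where
  "component i x =
     (THE d. d \<in> (\<Pi>\<^sub>E i\<in>I. D i) \<and> finite {i\<in>I. d i \<noteq> \<zero>\<^bsub>M\<^esub>} \<and>
        x = (\<Oplus>\<^bsub>M\<^esub>i\<in>{i\<in>I. d i \<noteq> \<zero>\<^bsub>M\<^esub>}. d i)) i"

abbreviation support :: "'a \<Rightarrow> 'i set" where
  "support x \<equiv> {i \<in> I. component i x \<noteq> \<zero>\<^bsub>M\<^esub>}"

lemma part_subgroup: "i \<in> I \<Longrightarrow> additive_subgroup (D i) M"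
  using decomp by (simp add: internal_direct_sum_def)

lemma part_carrier: "\<lbrakk>i \<in> I; x \<in> D i\<rbrakk> \<Longrightarrow> x \<in> carrier M"
  using additive_subgroup.a_Hcarr part_subgroup by metis

lemma part_zero: "i \<in> I \<Longrightarrow> \<zero>\<^bsub>M\<^esub> \<in> D i"
  using additive_subgroup.zero_closed part_subgroup by metis

lemma part_add: "\<lbrakk>i \<in> I; x \<in> D i; y \<in> D i\<rbrakk> \<Longrightarrow> x \<oplus>\<^bsub>M\<^esub> y \<in> D i"
  using additive_subgroup.a_closed part_subgroup by metis

lemma part_minus: "\<lbrakk>i \<in> I; x \<in> D i\<rbrakk> \<Longrightarrow> \<ominus>\<^bsub>M\<^esub> x \<in> D i"
  using additive_subgroup.a_inv_closed part_subgroup abelian_group_axioms by metis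

lemma component_decomp:
  assumes "x \<in> carrier M"
  shows "i \<in> I \<Longrightarrow> component i x \<in> D i" "finite (support x)"
    "x = (\<Oplus>\<^bsub>M\<^esub>i\<in>support x. component i x)"
proof -
  let ?P = "\<lambda>d. d \<in> (\<Pi>\<^sub>E i\<in>I. D i) \<and> finite {i\<in>I. d i \<noteq> \<zero>\<^bsub>M\<^esub>} \<and>
        x = (\<Oplus>\<^bsub>M\<^esub>i\<in>{i\<in>I. d i \<noteq> \<zero>\<^bsub>M\<^esub>}. d i)"
  have "\<exists>!d. ?P d"
    using decomp assms by (simp add: internal_direct_sum_def)
  from theI'[OF this] have "?P (\<lambda>i. component i x)"
    unfolding component_def .
  then show "i \<in> I \<Longrightarrow> component i x \<in> D i" "finite (support x)"
    "x = (\<Oplus>\<^bsub>M\<^esub>i\<in>support x. component i x)"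
    by auto
qed

lemma component_carrier: "\<lbrakk>x \<in> carrier M; i \<in> I\<rbrakk> \<Longrightarrow> component i x \<in> carrier M"
  using component_decomp(1) part_carrier by metis

lemma finsum_component:
  assumes "x \<in> carrier M" "finite J" "J \<subseteq> I" "support x \<subseteq> J"
  shows "(\<Oplus>\<^bsub>M\<^esub>i\<in>J. component i x) = x"
proof -
  have "(\<Oplus>\<^bsub>M\<^esub>i\<in>support x. component i x) = (\<Oplus>\<^bsub>M\<^esub>i\<in>J. component i x)"
    using assms by (intro add.finprod_mono_neutral_cong_left) (auto simp: component_carrier)
  then show ?thesis
    using component_decomp(3)[OF assms(1)] by simp
qed

text \<open>The working form of uniqueness: the given terms, padded by zero outside
  \<open>J\<close>, form an admissible family and hence are the family of components. Terms
  \<open>d j\<close> that vanish are permitted.\<close>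

lemma component_finsum_parts:
  assumes "finite J" "J \<subseteq> I" "\<And>j. j \<in> J \<Longrightarrow> d j \<in> D j" "i \<in> I"
  shows "component i (\<Oplus>\<^bsub>M\<^esub>j\<in>J. d j) = (if i \<in> J then d i else \<zero>\<^bsub>M\<^esub>)"
proof -
  let ?x = "\<Oplus>\<^bsub>M\<^esub>j\<in>J. d j"
  let ?d = "\<lambda>i\<in>I. if i \<in> J then d i else \<zero>\<^bsub>M\<^esub>"
  have dc: "d j \<in> carrier M" if "j \<in> J" for j
    using that assms(2,3) part_carrier by blast
  let ?P = "\<lambda>d. d \<in> (\<Pi>\<^sub>E i\<in>I. D i) \<and> finite {i\<in>I. d i \<noteq> \<zero>\<^bsub>M\<^esub>} \<and>
        ?x = (\<Oplus>\<^bsub>M\<^esub>i\<in>{i\<in>I. d i \<noteq> \<zero>\<^bsub>M\<^esub>}. d i)"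
  have x: "?x \<in> carrier M"
    using dc by auto
  have sub: "{i\<in>I. ?d i \<noteq> \<zero>\<^bsub>M\<^esub>} \<subseteq> J"
    by auto
  have "(\<Oplus>\<^bsub>M\<^esub>i\<in>{i\<in>I. ?d i \<noteq> \<zero>\<^bsub>M\<^esub>}. ?d i) = ?x"
    using assms(1,2) dc sub by (intro add.finprod_mono_neutral_cong_left) auto
  then have "?P ?d"
    using assms(3) part_zero finite_subset[OF sub assms(1)] by auto
  moreover have "\<exists>!d. ?P d"
    using decomp x by (simp add: internal_direct_sum_def)
  ultimately have "(THE d. ?P d) = ?d"
    by (intro the1_equality)
  then show ?thesis
    using assms(4) by (simp add: component_def)
qed

lemma component_part:
  assumes "j \<in> I" "x \<in> D j" "i \<in> I"
  shows "component i x = (if i = j then x else \<zero>\<^bsub>M\<^esub>)"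
  using component_finsum_parts[of "{j}" "\<lambda>_. x" i] assms part_carrier[of j x]
  by auto

lemma component_add:
  assumes "x \<in> carrier M" "y \<in> carrier M" "i \<in> I"
  shows "component i (x \<oplus>\<^bsub>M\<^esub> y) = component i x \<oplus>\<^bsub>M\<^esub> component i y"
proof -
  \<comment> \<open>One finite index set on which both elements can be expanded. It contains
    \<open>i\<close> so that the component read off is the term at \<open>i\<close> rather than the
    default zero.\<close>
  let ?J = "insert i (support x \<union> support y)"
  have J: "finite ?J" "?J \<subseteq> I"
    using component_decomp(2) assms by auto
  have "x \<oplus>\<^bsub>M\<^esub> y = (\<Oplus>\<^bsub>M\<^esub>j\<in>?J. component j x) \<oplus>\<^bsub>M\<^esub> (\<Oplus>\<^bsub>M\<^esub>j\<in>?J. component j y)"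
    using J assms(1,2) by (subst (1 2) finsum_component) auto
  also have "\<dots> = (\<Oplus>\<^bsub>M\<^esub>j\<in>?J. component j x \<oplus>\<^bsub>M\<^esub> component j y)"
    using J assms(1,2) by (intro finsum_addf[symmetric]) (auto intro!: component_carrier)
  finally show ?thesis
    using J assms component_finsum_parts[of ?J "\<lambda>j. component j x \<oplus>\<^bsub>M\<^esub> component j y" i]
    by (auto intro!: part_add component_decomp(1))
qed

lemma component_zero: "i \<in> I \<Longrightarrow> component i \<zero>\<^bsub>M\<^esub> = \<zero>\<^bsub>M\<^esub>"
  using component_part[of i "\<zero>\<^bsub>M\<^esub>" i] part_zero by simp

lemma component_finsum:
  assumes "finite J" "\<And>j. j \<in> J \<Longrightarrow> f j \<in> carrier M" "i \<in> I"
  shows "component i (\<Oplus>\<^bsub>M\<^esub>j\<in>J. f j) = (\<Oplus>\<^bsub>M\<^esub>j\<in>J. component i (f j))"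
  using assms(1,2)
proof (induction J)
  case (insert j J)
  then show ?case
    using assms(3) by (auto simp: component_add component_carrier Pi_def)
qed (use assms(3) in \<open>simp add: component_zero\<close>)

lemma component_eqI:
  assumes "x \<in> carrier M" "y \<in> carrier M" "\<And>i. i \<in> I \<Longrightarrow> component i x = component i y"
  shows "x = y"
proof -
  have "support x = support y"
    using assms(3) by auto
  then have "(\<Oplus>\<^bsub>M\<^esub>i\<in>support x. component i x) = (\<Oplus>\<^bsub>M\<^esub>i\<in>support y. component i y)"
    using assms by (intro finsum_cong') (auto simp: component_carrier)
  then show ?thesis
    using component_decomp(3)[OF assms(1)] component_decomp(3)[OF assms(2)] by simp
qed

text \<open>Identities that are additive in \<open>x\<close> need only be checked on homogeneous
  elements; the zero case is the empty sum.\<close>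

lemma homogeneous_induct [consumes 1, case_names zero homogeneous add]:
  assumes "x \<in> carrier M"
    and "P \<zero>\<^bsub>M\<^esub>"
    and "\<And>i x. \<lbrakk>i \<in> I; x \<in> D i\<rbrakk> \<Longrightarrow> P x"
    and "\<And>x y. \<lbrakk>x \<in> carrier M; y \<in> carrier M; P x; P y\<rbrakk> \<Longrightarrow> P (x \<oplus>\<^bsub>M\<^esub> y)"
  shows "P x"
proof -
  have "P (\<Oplus>\<^bsub>M\<^esub>i\<in>J. component i x)" if "finite J" "J \<subseteq> I" for J
    using that
  proof (induction J)
    case (insert j J)
    moreover have c: "(\<lambda>i. component i x) \<in> J \<rightarrow> carrier M" "component j x \<in> carrier M"
      using insert.prems assms(1) by (auto intro: component_carrier)
    moreover have "P (component j x)"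
      using assms(1,3) component_decomp(1) insert.prems by blast
    ultimately show ?case
      using assms(4)[OF c(2) finsum_closed[OF c(1)]] by simp
  qed (use assms(2) in simp)
  then have "P (\<Oplus>\<^bsub>M\<^esub>i\<in>support x. component i x)"
    using component_decomp(2)[OF assms(1)] by auto
  then show ?thesis
    using component_decomp(3)[OF assms(1)] by simp
qed

text \<open>A homogeneous decomposition inside \<open>B\<close> is also one in \<open>M\<close>, so
  its terms must be the components in \<open>M\<close>. Conversely, components that stay in
  \<open>B\<close> provide the decomposition. This replaces the definition of a graded submodule by
  a closure condition.\<close>

lemma internal_direct_sum_subgroup_iff:
  assumes "additive_subgroup B M"
  shows "internal_direct_sum I (M\<lparr>carrier := B\<rparr>) (\<lambda>i. B \<inter> D i) \<longleftrightarrow>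
    (\<forall>x\<in>B. \<forall>i\<in>I. component i x \<in> B)" (is "?L \<longleftrightarrow> ?R")
proof -
  interpret B: additive_subgroup B M by fact
  have B: "B \<subseteq> carrier M"
    by (rule B.a_subset)
  note sum = finsum_subgroup[OF assms]
  show ?thesis
  proof
    assume L: ?L
    show ?R
    proof (intro ballI)
      fix x i assume x: "x \<in> B" and i: "i \<in> I"
      obtain d where d: "d \<in> (\<Pi>\<^sub>E i\<in>I. B \<inter> D i)" "finite {i\<in>I. d i \<noteq> \<zero>\<^bsub>M\<^esub>}"
        "x = (\<Oplus>\<^bsub>M\<lparr>carrier := B\<rparr>\<^esub>i\<in>{i\<in>I. d i \<noteq> \<zero>\<^bsub>M\<^esub>}. d i)"
        using L x unfolding internal_direct_sum_def by (auto dest!: bspec[of _ _ x] ex1_implies_ex)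
      have "x = (\<Oplus>\<^bsub>M\<^esub>i\<in>{i\<in>I. d i \<noteq> \<zero>\<^bsub>M\<^esub>}. d i)"
        using d by (subst sum(1)[symmetric]) (auto simp: PiE_iff)
      then have "component i x = (if i \<in> {i\<in>I. d i \<noteq> \<zero>\<^bsub>M\<^esub>} then d i else \<zero>\<^bsub>M\<^esub>)"
        using component_finsum_parts[of "{i\<in>I. d i \<noteq> \<zero>\<^bsub>M\<^esub>}" d i] d i by (auto simp: PiE_iff)
      then show "component i x \<in> B"
        using d(1) i by auto
    qed
  next
    assume R: ?R
    have sub: "additive_subgroup (B \<inter> D i) (M\<lparr>carrier := B\<rparr>)" if "i \<in> I" for i
    proof -
      have *: "subgroup B (add_monoid M)" "subgroup (D i) (add_monoid M)"
        using assms part_subgroup[OF that] by (auto simp: additive_subgroup_def)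
      have "subgroup (B \<inter> D i) ((add_monoid M)\<lparr>carrier := B\<rparr>)"
        using add.subgroup_incl[OF add.subgroups_Inter_pair[OF *] *(1)] by simp
      then show ?thesis
        by (simp add: additive_subgroup_def)
    qed
    moreover have "\<exists>!d. d \<in> (\<Pi>\<^sub>E i\<in>I. B \<inter> D i) \<and> finite {i\<in>I. d i \<noteq> \<zero>\<^bsub>M\<^esub>} \<and>
        x = (\<Oplus>\<^bsub>M\<lparr>carrier := B\<rparr>\<^esub>i\<in>{i\<in>I. d i \<noteq> \<zero>\<^bsub>M\<^esub>}. d i)" if x: "x \<in> B" for x
    proof (rule ex1I)
      let ?d = "\<lambda>i\<in>I. component i x"
      have xM: "x \<in> carrier M"
        using x B by auto
      have eq: "{i\<in>I. ?d i \<noteq> \<zero>\<^bsub>M\<^esub>} = support x"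
        by auto
      have "(\<Oplus>\<^bsub>M\<lparr>carrier := B\<rparr>\<^esub>i\<in>support x. ?d i) = (\<Oplus>\<^bsub>M\<^esub>i\<in>support x. ?d i)"
        using component_decomp(2)[OF xM] R x by (intro sum(1)) auto
      also have "\<dots> = (\<Oplus>\<^bsub>M\<^esub>i\<in>support x. component i x)"
        using xM by (intro finsum_cong') (auto simp: component_carrier)
      also have "\<dots> = x"
        using component_decomp(3)[OF xM] by simp
      finally show "?d \<in> (\<Pi>\<^sub>E i\<in>I. B \<inter> D i) \<and> finite {i\<in>I. ?d i \<noteq> \<zero>\<^bsub>M\<^esub>} \<and>
        x = (\<Oplus>\<^bsub>M\<lparr>carrier := B\<rparr>\<^esub>i\<in>{i\<in>I. ?d i \<noteq> \<zero>\<^bsub>M\<^esub>}. ?d i)"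
        unfolding eq using R x component_decomp(1)[OF xM] component_decomp(2)[OF xM]
        by (simp add: PiE_iff)
      fix d assume d: "d \<in> (\<Pi>\<^sub>E i\<in>I. B \<inter> D i) \<and> finite {i\<in>I. d i \<noteq> \<zero>\<^bsub>M\<^esub>} \<and>
        x = (\<Oplus>\<^bsub>M\<lparr>carrier := B\<rparr>\<^esub>i\<in>{i\<in>I. d i \<noteq> \<zero>\<^bsub>M\<^esub>}. d i)"
      have dx: "x = (\<Oplus>\<^bsub>M\<^esub>i\<in>{i\<in>I. d i \<noteq> \<zero>\<^bsub>M\<^esub>}. d i)"
        using d by (subst sum(1)[symmetric]) (auto simp: PiE_iff)
      show "d = ?d"
      proof
        fix i
        show "d i = ?d i"
          using component_finsum_parts[of "{i\<in>I. d i \<noteq> \<zero>\<^bsub>M\<^esub>}" d i] d dx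
          by (cases "i \<in> I") (auto simp: PiE_iff extensional_def)
      qed
    qed
    ultimately show ?L
      by (simp add: internal_direct_sum_def)
  qed
qed

end

section \<open>Endomorphism rings of right modules\<close>

lemma Hom_modD:
  assumes "f \<in> Hom_mod R M N"
  shows "x \<in> carrier M \<Longrightarrow> f x \<in> carrier N"
    and "\<lbrakk>x \<in> carrier M; y \<in> carrier M\<rbrakk> \<Longrightarrow> f (x \<oplus>\<^bsub>M\<^esub> y) = f x \<oplus>\<^bsub>N\<^esub> f y"
    and "\<lbrakk>x \<in> carrier M; a \<in> carrier R\<rbrakk> \<Longrightarrow> f (x \<star>\<^bsub>M\<^esub> a) = f x \<star>\<^bsub>N\<^esub> a"
    and "f \<in> extensional (carrier M)"
  using assms by (auto simp: Hom_mod_def PiE_iff)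

lemma Hom_modI:
  assumes "f \<in> extensional (carrier M)"
    and "\<And>x. x \<in> carrier M \<Longrightarrow> f x \<in> carrier N"
    and "\<And>x y. \<lbrakk>x \<in> carrier M; y \<in> carrier M\<rbrakk> \<Longrightarrow> f (x \<oplus>\<^bsub>M\<^esub> y) = f x \<oplus>\<^bsub>N\<^esub> f y"
    and "\<And>x a. \<lbrakk>x \<in> carrier M; a \<in> carrier R\<rbrakk> \<Longrightarrow> f (x \<star>\<^bsub>M\<^esub> a) = f x \<star>\<^bsub>N\<^esub> a"
  shows "f \<in> Hom_mod R M N"
  using assms by (auto simp: Hom_mod_def PiE_iff)

context right_module
begin

lemma rsmult_l_zero: "a \<in> carrier R \<Longrightarrow> \<zero>\<^bsub>M\<^esub> \<star>\<^bsub>M\<^esub> a = \<zero>\<^bsub>M\<^esub>"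
  using rsmult_l_distr[of "\<zero>\<^bsub>M\<^esub>" "\<zero>\<^bsub>M\<^esub>" a] rsmult_closed[of "\<zero>\<^bsub>M\<^esub>" a]
  by (simp add: M.add.l_cancel_one')

lemma rsmult_l_minus:
  assumes "x \<in> carrier M" "a \<in> carrier R"
  shows "(\<ominus>\<^bsub>M\<^esub> x) \<star>\<^bsub>M\<^esub> a = \<ominus>\<^bsub>M\<^esub> (x \<star>\<^bsub>M\<^esub> a)"
proof -
  have "(\<ominus>\<^bsub>M\<^esub> x) \<star>\<^bsub>M\<^esub> a \<oplus>\<^bsub>M\<^esub> x \<star>\<^bsub>M\<^esub> a = \<zero>\<^bsub>M\<^esub>"
    using assms rsmult_l_distr[of "\<ominus>\<^bsub>M\<^esub> x" x a] by (simp add: M.l_neg rsmult_l_zero)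
  then show ?thesis
    using M.minus_equality assms rsmult_closed by simp
qed

lemma hom_zero:
  assumes "f \<in> Hom_mod R M M"
  shows "f \<zero>\<^bsub>M\<^esub> = \<zero>\<^bsub>M\<^esub>"
  using Hom_modD(2)[OF assms, of "\<zero>\<^bsub>M\<^esub>" "\<zero>\<^bsub>M\<^esub>"] Hom_modD(1)[OF assms, of "\<zero>\<^bsub>M\<^esub>"]
  by (simp add: M.add.l_cancel_one')

lemma hom_finsum:
  assumes "f \<in> Hom_mod R M M" "finite J" "\<And>j. j \<in> J \<Longrightarrow> u j \<in> carrier M"
  shows "f (\<Oplus>\<^bsub>M\<^esub>j\<in>J. u j) = (\<Oplus>\<^bsub>M\<^esub>j\<in>J. f (u j))"
  using assms(2,3)
proof (induction J)
  case (insert j J)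
  then show ?case
    using Hom_modD(1,2)[OF assms(1)] by (auto simp: Pi_def)
qed (simp add: hom_zero[OF assms(1)])

lemma End_ring_simps:
  "carrier (End_ring R M) = Hom_mod R M M"
  "f \<otimes>\<^bsub>End_ring R M\<^esub> g = compose (carrier M) f g"
  "\<one>\<^bsub>End_ring R M\<^esub> = (\<lambda>x\<in>carrier M. x)"
  "\<zero>\<^bsub>End_ring R M\<^esub> = (\<lambda>x\<in>carrier M. \<zero>\<^bsub>M\<^esub>)"
  "f \<oplus>\<^bsub>End_ring R M\<^esub> g = (\<lambda>x\<in>carrier M. f x \<oplus>\<^bsub>M\<^esub> g x)"
  by (simp_all add: End_ring_def)

lemma neg_hom:
  assumes "f \<in> Hom_mod R M M"
  shows "(\<lambda>x\<in>carrier M. \<ominus>\<^bsub>M\<^esub> f x) \<in> Hom_mod R M M"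
    and "(\<lambda>x\<in>carrier M. \<ominus>\<^bsub>M\<^esub> f x) \<oplus>\<^bsub>End_ring R M\<^esub> f = \<zero>\<^bsub>End_ring R M\<^esub>"
  using Hom_modD[OF assms]
  by (auto intro!: Hom_modI restrict_ext
      simp: M.minus_add rsmult_closed rsmult_l_minus M.l_neg End_ring_simps)

lemma ring_End_ring: "ring (End_ring R M)"
proof (rule ringI)
  show "abelian_group (End_ring R M)"
  proof (rule abelian_groupI)
    fix f assume "f \<in> carrier (End_ring R M)"
    then show "\<exists>g\<in>carrier (End_ring R M). g \<oplus>\<^bsub>End_ring R M\<^esub> f = \<zero>\<^bsub>End_ring R M\<^esub>"
      using neg_hom by (auto simp: End_ring_simps(1))
    show "\<zero>\<^bsub>End_ring R M\<^esub> \<oplus>\<^bsub>End_ring R M\<^esub> f = f"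
      using Hom_modD(1,4)[of f R M M] \<open>f \<in> carrier (End_ring R M)\<close>
      by (auto simp: End_ring_simps extensional_def)
  qed (auto simp: End_ring_simps Hom_modD M.a_ac rsmult_closed rsmult_l_distr rsmult_l_zero
      intro!: Hom_modI restrict_ext)
  show "monoid (End_ring R M)"
  proof (rule monoidI)
    fix f assume "f \<in> carrier (End_ring R M)"
    then have f: "f \<in> Hom_mod R M M"
      by (simp add: End_ring_simps)
    then show "\<one>\<^bsub>End_ring R M\<^esub> \<otimes>\<^bsub>End_ring R M\<^esub> f = f" "f \<otimes>\<^bsub>End_ring R M\<^esub> \<one>\<^bsub>End_ring R M\<^esub> = f"
      using Hom_modD(1,4)[OF f]
      by (auto simp: End_ring_simps compose_def extensional_def)
  qed (auto simp: End_ring_simps Hom_modD compose_def rsmult_closed intro!: Hom_modI restrict_ext)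
qed (auto simp: End_ring_simps Hom_modD compose_def intro!: restrict_ext)

end

section \<open>Graded endomorphisms\<close>

context graded_right_module
begin

sublocale MD: direct_sum_decomp "carrier G" M Mg
  by unfold_locales (rule module_decomp)

sublocale RD: direct_sum_decomp "carrier G" R Rg
  by unfold_locales (rule ring_decomp)

abbreviation grEnd :: "('m \<Rightarrow> 'm) ring" where
  "grEnd \<equiv> identity_component G (End_ring R M) (Hom_deg G R M Mg M Mg)"

text \<open>Taking the component overwrites the carrier, the only field in which
  \<open>END_ring\<close> and \<open>End_ring\<close> differ. The equivalences for
  \<open>End\<close> thus concern the very same ring \<open>S_\<epsilon>\<close>.\<close>

lemma identity_component_END_ring:
  "identity_component G (END_ring G R M Mg) Sg = identity_component G (End_ring R M) Sg"
  by (simp add: identity_component_def END_ring_def)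

lemma grEnd_simps:
  "f \<otimes>\<^bsub>grEnd\<^esub> g = compose (carrier M) f g"
  "\<one>\<^bsub>grEnd\<^esub> = (\<lambda>x\<in>carrier M. x)"
  "\<zero>\<^bsub>grEnd\<^esub> = (\<lambda>x\<in>carrier M. \<zero>\<^bsub>M\<^esub>)"
  "f \<oplus>\<^bsub>grEnd\<^esub> g = (\<lambda>x\<in>carrier M. f x \<oplus>\<^bsub>M\<^esub> g x)"
  by (simp_all add: identity_component_def End_ring_def)

lemma grEnd_iff:
  "f \<in> carrier grEnd \<longleftrightarrow>
    f \<in> Hom_mod R M M \<and> (\<forall>\<delta>\<in>carrier G. \<forall>x\<in>Mg \<delta>. f x \<in> Mg \<delta>)"
  by (auto simp: identity_component_def Hom_deg_def)

lemma grEndD: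
  assumes "f \<in> carrier grEnd"
  shows "f \<in> Hom_mod R M M" "\<lbrakk>\<delta> \<in> carrier G; x \<in> Mg \<delta>\<rbrakk> \<Longrightarrow> f x \<in> Mg \<delta>"
    "x \<in> carrier M \<Longrightarrow> f x \<in> carrier M"
  using assms Hom_modD(1) by (auto simp: grEnd_iff)

lemma ring_grEnd: "ring grEnd"
proof -
  interpret E: ring "End_ring R M"
    by (rule ring_End_ring)
  have eq: "grEnd = End_ring R M\<lparr>carrier := carrier grEnd\<rparr>"
    by (simp add: identity_component_def)
  have neg: "\<ominus>\<^bsub>End_ring R M\<^esub> f = (\<lambda>x\<in>carrier M. \<ominus>\<^bsub>M\<^esub> f x)" if "f \<in> Hom_mod R M M" for f
    using neg_hom[OF that] that by (intro E.minus_equality) (auto simp: End_ring_simps(1))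
  have "subring (carrier grEnd) (End_ring R M)"
  proof (rule E.subringI)
    show "carrier grEnd \<subseteq> carrier (End_ring R M)"
      by (auto simp: grEnd_iff End_ring_simps)
    show "\<one>\<^bsub>End_ring R M\<^esub> \<in> carrier grEnd"
      using E.one_closed MD.part_carrier by (auto simp: grEnd_iff End_ring_simps)
    fix f assume f: "f \<in> carrier grEnd"
    then show "\<ominus>\<^bsub>End_ring R M\<^esub> f \<in> carrier grEnd"
      using neg_hom(1)[of f] MD.part_carrier
      by (auto simp: grEnd_iff neg intro: MD.part_minus)
    fix g assume g: "g \<in> carrier grEnd"
    show "f \<otimes>\<^bsub>End_ring R M\<^esub> g \<in> carrier grEnd"
      using f g E.m_closed[of f g] MD.part_carrier
      by (auto simp: grEnd_iff End_ring_simps compose_def)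
    show "f \<oplus>\<^bsub>End_ring R M\<^esub> g \<in> carrier grEnd"
      using f g E.a_closed[of f g] MD.part_carrier
      by (auto simp: grEnd_iff End_ring_simps intro: MD.part_add)
  qed
  from E.subring_is_ring[OF this] show ?thesis
    using eq by simp
qed

sublocale S: ring grEnd
  by (rule ring_grEnd)

text \<open>Both sides are additive in \<open>x\<close> and agree on homogeneous elements, whose
  degree \<open>f\<close> preserves. The lemma makes images of graded endomorphisms graded and later
  controls the degree of an inverse.\<close>

lemma grEnd_component:
  assumes f: "f \<in> carrier grEnd" and \<gamma>: "\<gamma> \<in> carrier G" and x: "x \<in> carrier M"
  shows "MD.component \<gamma> (f x) = f (MD.component \<gamma> x)"
  using x
proof (induction x rule: MD.homogeneous_induct)
  case zero
  then show ?case
    using hom_zero[OF grEndD(1)[OF f]] \<gamma> by (simp add: MD.component_zero)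
next
  case (homogeneous \<delta> x)
  then show ?case
    using hom_zero[OF grEndD(1)[OF f]] \<gamma> grEndD(2)[OF f]
    by (auto simp: MD.component_part[of \<delta>])
next
  case (add x y)
  then show ?case
    using \<gamma> Hom_modD(2)[OF grEndD(1)[OF f]] grEndD(3)[OF f]
    by (simp add: MD.component_add MD.component_carrier)
qed

section \<open>Graded decompositions and idempotents of degree \<epsilon>\<close>

lemma graded_submodule_iff:
  "graded_submodule G R M Mg B \<longleftrightarrow>
    right_submodule R M B \<and> (\<forall>x\<in>B. \<forall>\<gamma>\<in>carrier G. MD.component \<gamma> x \<in> B)"
  using MD.internal_direct_sum_subgroup_iff
  by (auto simp: graded_submodule_def right_submodule_def)

lemma idempotent_apply:
  assumes "e \<in> idempotents grEnd"
  shows "e \<in> carrier grEnd" "x \<in> carrier M \<Longrightarrow> e (e x) = e x"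
    "y \<in> e ` carrier M \<longleftrightarrow> y \<in> carrier M \<and> e y = y"
proof -
  show e: "e \<in> carrier grEnd"
    using assms by (simp add: idempotents_def)
  have "compose (carrier M) e e = e"
    using assms by (simp add: idempotents_def grEnd_simps)
  then show *: "x \<in> carrier M \<Longrightarrow> e (e x) = e x" for x
    by (metis compose_eq)
  show "y \<in> e ` carrier M \<longleftrightarrow> y \<in> carrier M \<and> e y = y"
    using * grEndD(3)[OF e] by (metis (no_types, lifting) image_iff)
qed

lemma compl_apply:
  assumes "e \<in> carrier grEnd" "x \<in> carrier M"
  shows "e x \<oplus>\<^bsub>M\<^esub> (\<one>\<^bsub>grEnd\<^esub> \<ominus>\<^bsub>grEnd\<^esub> e) x = x"
proof -
  have "(e \<oplus>\<^bsub>grEnd\<^esub> (\<one>\<^bsub>grEnd\<^esub> \<ominus>\<^bsub>grEnd\<^esub> e)) x = \<one>\<^bsub>grEnd\<^esub> x"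
    by (simp only: S.add_compl[OF assms(1)])
  then show ?thesis
    using assms(2) by (simp add: grEnd_simps)
qed

lemma graded_submodule_image:
  assumes "e \<in> carrier grEnd"
  shows "graded_submodule G R M Mg (e ` carrier M)"
proof -
  note D = Hom_modD[OF grEndD(1)[OF assms]]
  have zero: "\<zero>\<^bsub>M\<^esub> \<in> e ` carrier M"
    using hom_zero[OF grEndD(1)[OF assms]] by (metis M.zero_closed image_eqI)
  have add: "e x \<oplus>\<^bsub>M\<^esub> e y \<in> e ` carrier M" if "x \<in> carrier M" "y \<in> carrier M" for x y
    using that by (metis D(2) M.a_closed image_eqI)
  have neg: "\<ominus>\<^bsub>M\<^esub> e x \<in> e ` carrier M" if x: "x \<in> carrier M" for x
  proof -
    have "e (\<ominus>\<^bsub>M\<^esub> x) \<oplus>\<^bsub>M\<^esub> e x = \<zero>\<^bsub>M\<^esub>"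
      using x D(2)[of "\<ominus>\<^bsub>M\<^esub> x" x] hom_zero[OF grEndD(1)[OF assms]] by (simp add: M.l_neg)
    then have "\<ominus>\<^bsub>M\<^esub> e x = e (\<ominus>\<^bsub>M\<^esub> x)"
      using x D(1) by (intro M.minus_equality) auto
    then show ?thesis
      using x by auto
  qed
  have "additive_subgroup (e ` carrier M) M"
    unfolding additive_subgroup_def
    using zero add neg D(1) by (intro M.add.subgroupI) (auto simp flip: a_inv_def)
  moreover have "e x \<star>\<^bsub>M\<^esub> a \<in> e ` carrier M" if "x \<in> carrier M" "a \<in> carrier R" for x a
    using that by (metis D(3) rsmult_closed image_eqI)
  moreover have "MD.component \<gamma> (e x) \<in> e ` carrier M"
    if "x \<in> carrier M" "\<gamma> \<in> carrier G" for x \<gamma>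
    using that grEnd_component[OF assms] MD.component_carrier by (metis image_eqI)
  ultimately show ?thesis
    by (auto simp: graded_submodule_iff right_submodule_def)
qed

lemma direct_sum_image_compl:
  assumes "e \<in> idempotents grEnd"
  shows "is_direct_sum2 M (e ` carrier M) ((\<one>\<^bsub>grEnd\<^esub> \<ominus>\<^bsub>grEnd\<^esub> e) ` carrier M)"
proof -
  let ?c = "\<one>\<^bsub>grEnd\<^esub> \<ominus>\<^bsub>grEnd\<^esub> e"
  note e = idempotent_apply[OF assms]
  have c: "?c \<in> idempotents grEnd"
    using S.compl_idempotent[OF assms] .
  note c' = idempotent_apply[OF c]
  have "x \<in> e ` carrier M <+>\<^bsub>M\<^esub> ?c ` carrier M \<longleftrightarrow> x \<in> carrier M" for x
    using compl_apply[OF e(1), of x] grEndD(3)[OF e(1)] grEndD(3)[OF c'(1)]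
    by (force simp: set_add_def')
  \<comment> \<open>An element fixed by both idempotents satisfies \<open>x + x = x\<close>.\<close>
  moreover have "x = \<zero>\<^bsub>M\<^esub>" if "x \<in> e ` carrier M" "x \<in> ?c ` carrier M" for x
    using compl_apply[OF e(1), of x] that e(3)[of x] c'(3)[of x] M.add.l_cancel_one'[of x x]
    by simp
  moreover have "\<zero>\<^bsub>M\<^esub> \<in> e ` carrier M" "\<zero>\<^bsub>M\<^esub> \<in> ?c ` carrier M"
    using hom_zero[OF grEndD(1)[OF e(1)]] hom_zero[OF grEndD(1)[OF c'(1)]]
    by (metis M.zero_closed image_eqI)+
  ultimately show ?thesis
    unfolding is_direct_sum2_def by blast
qed

text \<open>The idempotent is the projection onto \<open>B\<close> along \<open>C\<close>. It
  preserves degrees because \<open>B\<close> and \<open>C\<close> are closed under components, so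
  that splitting an element commutes with taking its components.\<close>

lemma direct_sum_projection:
  assumes B: "graded_submodule G R M Mg B" and C: "graded_submodule G R M Mg C"
    and BC: "is_direct_sum2 M B C"
  obtains e where "e \<in> idempotents grEnd" "e ` carrier M = B"
    "(\<one>\<^bsub>grEnd\<^esub> \<ominus>\<^bsub>grEnd\<^esub> e) ` carrier M = C"
proof -
  interpret B: additive_subgroup B M
    using B by (simp add: graded_submodule_def right_submodule_def)
  interpret C: additive_subgroup C M
    using C by (simp add: graded_submodule_def right_submodule_def)
  have smult: "\<lbrakk>x \<in> B; a \<in> carrier R\<rbrakk> \<Longrightarrow> x \<star>\<^bsub>M\<^esub> a \<in> B"
    "\<lbrakk>x \<in> C; a \<in> carrier R\<rbrakk> \<Longrightarrow> x \<star>\<^bsub>M\<^esub> a \<in> C" for x a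
    using B C by (auto simp: graded_submodule_def right_submodule_def)
  have comp: "\<lbrakk>x \<in> B; \<gamma> \<in> carrier G\<rbrakk> \<Longrightarrow> MD.component \<gamma> x \<in> B"
    "\<lbrakk>x \<in> C; \<gamma> \<in> carrier G\<rbrakk> \<Longrightarrow> MD.component \<gamma> x \<in> C" for x \<gamma>
    using B C by (auto simp: graded_submodule_iff)
  have int: "B \<inter> C = {\<zero>\<^bsub>M\<^esub>}" and sum: "carrier M = B <+>\<^bsub>M\<^esub> C"
    using BC by (auto simp: is_direct_sum2_def)
  have uniq: "b = b' \<and> c = c'"
    if "b \<in> B" "b' \<in> B" "c \<in> C" "c' \<in> C" "b \<oplus>\<^bsub>M\<^esub> c = b' \<oplus>\<^bsub>M\<^esub> c'" for b b' c c'
  proof -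
    have carr: "b \<in> carrier M" "b' \<in> carrier M" "c \<in> carrier M" "c' \<in> carrier M"
      using that B.a_Hcarr C.a_Hcarr by auto
    \<comment> \<open>This common difference lies in \<open>B\<close> and in \<open>C\<close>, hence
      is zero.\<close>
    have "b \<ominus>\<^bsub>M\<^esub> b' = c' \<ominus>\<^bsub>M\<^esub> c"
    proof -
      have "b \<ominus>\<^bsub>M\<^esub> b' = (b \<oplus>\<^bsub>M\<^esub> c) \<ominus>\<^bsub>M\<^esub> c \<ominus>\<^bsub>M\<^esub> b'"
        using carr by (simp add: a_minus_def M.a_assoc M.r_neg)
      also have "\<dots> = c' \<ominus>\<^bsub>M\<^esub> c"
        using carr M.a_lcomm[of b' c' "\<ominus>\<^bsub>M\<^esub> b' \<oplus>\<^bsub>M\<^esub> \<ominus>\<^bsub>M\<^esub> c"] unfolding that(5)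
        by (simp add: a_minus_def M.a_assoc M.a_comm[of "\<ominus>\<^bsub>M\<^esub> c" "\<ominus>\<^bsub>M\<^esub> b'"] M.r_neg2)
      finally show ?thesis .
    qed
    moreover have "b \<ominus>\<^bsub>M\<^esub> b' \<in> B" "c' \<ominus>\<^bsub>M\<^esub> c \<in> C"
      using that B.a_inv_closed C.a_inv_closed M.abelian_group_axioms
      by (auto simp: a_minus_def)
    ultimately have "b \<ominus>\<^bsub>M\<^esub> b' = \<zero>\<^bsub>M\<^esub>" "c' \<ominus>\<^bsub>M\<^esub> c = \<zero>\<^bsub>M\<^esub>"
      using int by auto
    then show ?thesis
      using carr M.minus_equality[of b "\<ominus>\<^bsub>M\<^esub> b'"] M.minus_equality[of c' "\<ominus>\<^bsub>M\<^esub> c"]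
      by (simp add: a_minus_def)
  qed
  define e where "e = (\<lambda>x\<in>carrier M. THE b. b \<in> B \<and> (\<exists>c\<in>C. x = b \<oplus>\<^bsub>M\<^esub> c))"
  have e_eq: "e (b \<oplus>\<^bsub>M\<^esub> c) = b" if "b \<in> B" "c \<in> C" for b c
  proof -
    have "b \<oplus>\<^bsub>M\<^esub> c \<in> carrier M"
      using that B.a_Hcarr C.a_Hcarr by auto
    moreover have "(THE b'. b' \<in> B \<and> (\<exists>c'\<in>C. b \<oplus>\<^bsub>M\<^esub> c = b' \<oplus>\<^bsub>M\<^esub> c')) = b"
      using that uniq by (intro the_equality) blast+
    ultimately show ?thesis
      by (simp add: e_def)
  qed
  have dec: "\<exists>b\<in>B. \<exists>c\<in>C. x = b \<oplus>\<^bsub>M\<^esub> c" if "x \<in> carrier M" for x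
    using that unfolding sum by (auto simp: set_add_def')
  have e_hom: "e \<in> Hom_mod R M M"
  proof (rule Hom_modI)
    show "e \<in> extensional (carrier M)"
      by (simp add: e_def)
    fix x assume "x \<in> carrier M"
    then obtain b c where x: "b \<in> B" "c \<in> C" "x = b \<oplus>\<^bsub>M\<^esub> c"
      using dec by blast
    then show "e x \<in> carrier M"
      using e_eq B.a_Hcarr by simp
    show "e (x \<star>\<^bsub>M\<^esub> a) = e x \<star>\<^bsub>M\<^esub> a" if "a \<in> carrier R" for a
      using x that smult B.a_Hcarr C.a_Hcarr by (simp add: rsmult_l_distr e_eq)
    fix y assume "y \<in> carrier M"
    then obtain b' c' where y: "b' \<in> B" "c' \<in> C" "y = b' \<oplus>\<^bsub>M\<^esub> c'"
      using dec by blast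
    have "x \<oplus>\<^bsub>M\<^esub> y = (b \<oplus>\<^bsub>M\<^esub> b') \<oplus>\<^bsub>M\<^esub> (c \<oplus>\<^bsub>M\<^esub> c')"
      using x y B.a_Hcarr C.a_Hcarr by (simp add: M.a_ac)
    then show "e (x \<oplus>\<^bsub>M\<^esub> y) = e x \<oplus>\<^bsub>M\<^esub> e y"
      using x y e_eq by simp
  qed
  have "e x \<in> Mg \<delta>" if \<delta>: "\<delta> \<in> carrier G" and x\<delta>: "x \<in> Mg \<delta>" for \<delta> x
  proof -
    obtain b c where x: "b \<in> B" "c \<in> C" "x = b \<oplus>\<^bsub>M\<^esub> c"
      using dec[OF MD.part_carrier[OF \<delta> x\<delta>]] by blast
    \<comment> \<open>Taking the \<delta>-component of \<open>x = b + c\<close> gives back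
      \<open>x\<close>, now split into homogeneous elements of \<open>B\<close> and
      \<open>C\<close>; \<open>e\<close> picks out the first of them.\<close>
    have "x = MD.component \<delta> x"
      using \<delta> x\<delta> by (simp add: MD.component_part[of \<delta>])
    also have "\<dots> = MD.component \<delta> b \<oplus>\<^bsub>M\<^esub> MD.component \<delta> c"
      using x \<delta> x\<delta> B.a_Hcarr C.a_Hcarr by (simp add: MD.component_add)
    finally have x_eq: "x = MD.component \<delta> b \<oplus>\<^bsub>M\<^esub> MD.component \<delta> c" .
    have "e (MD.component \<delta> b \<oplus>\<^bsub>M\<^esub> MD.component \<delta> c) = MD.component \<delta> b"
      using comp x(1,2) \<delta> by (intro e_eq)
    then have "e x = MD.component \<delta> b"
      by (simp only: x_eq[symmetric])
    then show ?thesis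
      using MD.component_decomp(1) x B.a_Hcarr \<delta> x\<delta> by simp
  qed
  then have e: "e \<in> carrier grEnd"
    using e_hom by (simp add: grEnd_iff)
  have eB: "e b = b" if "b \<in> B" for b
    using e_eq[OF that C.zero_closed] B.a_Hcarr that by simp
  have ex: "e x \<in> B" if "x \<in> carrier M" for x
    using dec[OF that] e_eq by auto
  have "e \<otimes>\<^bsub>grEnd\<^esub> e = e"
    unfolding grEnd_simps
    by (rule extensionalityI[OF compose_extensional Hom_modD(4)[OF e_hom]])
      (simp add: compose_eq eB ex)
  then have idem: "e \<in> idempotents grEnd"
    using e by (simp add: idempotents_def)
  have c_eq: "(\<one>\<^bsub>grEnd\<^esub> \<ominus>\<^bsub>grEnd\<^esub> e) (b \<oplus>\<^bsub>M\<^esub> c) = c" if "b \<in> B" "c \<in> C" for b c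
  proof -
    have "b \<oplus>\<^bsub>M\<^esub> (\<one>\<^bsub>grEnd\<^esub> \<ominus>\<^bsub>grEnd\<^esub> e) (b \<oplus>\<^bsub>M\<^esub> c) = b \<oplus>\<^bsub>M\<^esub> c"
      using compl_apply[OF e, of "b \<oplus>\<^bsub>M\<^esub> c"] that B.a_Hcarr C.a_Hcarr by (simp add: e_eq)
    moreover have "(\<one>\<^bsub>grEnd\<^esub> \<ominus>\<^bsub>grEnd\<^esub> e) (b \<oplus>\<^bsub>M\<^esub> c) \<in> carrier M"
      by (rule grEndD(3)[OF S.minus_closed[OF S.one_closed e]
            M.a_closed[OF B.a_Hcarr[OF that(1)] C.a_Hcarr[OF that(2)]]])
    ultimately show ?thesis
      using M.r_neg1[OF B.a_Hcarr[OF that(1)]] C.a_Hcarr[OF that(2)] by metis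
  qed
  have "(\<one>\<^bsub>grEnd\<^esub> \<ominus>\<^bsub>grEnd\<^esub> e) ` carrier M = C"
  proof
    show "(\<one>\<^bsub>grEnd\<^esub> \<ominus>\<^bsub>grEnd\<^esub> e) ` carrier M \<subseteq> C"
    proof
      fix z assume "z \<in> (\<one>\<^bsub>grEnd\<^esub> \<ominus>\<^bsub>grEnd\<^esub> e) ` carrier M"
      then obtain x where x: "x \<in> carrier M" "z = (\<one>\<^bsub>grEnd\<^esub> \<ominus>\<^bsub>grEnd\<^esub> e) x"
        by (rule imageE)
      then show "z \<in> C"
        using dec[OF x(1)] c_eq by auto
    qed
    show "C \<subseteq> (\<one>\<^bsub>grEnd\<^esub> \<ominus>\<^bsub>grEnd\<^esub> e) ` carrier M"
    proof
      fix c assume c: "c \<in> C"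
      show "c \<in> (\<one>\<^bsub>grEnd\<^esub> \<ominus>\<^bsub>grEnd\<^esub> e) ` carrier M"
        using c_eq[OF B.zero_closed c] C.a_Hcarr[OF c] by (intro image_eqI[of _ _ c]) simp_all
    qed
  qed
  moreover have "e ` carrier M = B"
    using ex eB B.a_subset by (metis equalityI image_subsetI image_eqI subset_iff)
  ultimately show thesis
    using that idem by blast
qed

text \<open>The isomorphism is \<open>y\<close>: since \<open>f y = y\<close> it lands in
  \<open>fA\<close>, and \<open>x\<close> inverts it because \<open>x y = e\<close> and
  \<open>y x = f\<close> act as identities on \<open>eA\<close> and \<open>fA\<close>. It is
  restricted to \<open>eA\<close> since homomorphisms are extensional on their domain.\<close>

lemma idem_equiv_imp_graded_isomorphic:
  assumes "idem_equiv grEnd e f" "e \<in> idempotents grEnd" "f \<in> idempotents grEnd"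
  shows "graded_isomorphic_sub G R M Mg (e ` carrier M) (f ` carrier M)"
proof -
  obtain x y where x: "x \<in> carrier grEnd" and y: "y \<in> carrier grEnd"
    and xy: "compose (carrier M) x y = e" "compose (carrier M) y x = f"
    and ex: "compose (carrier M) e x = x" and fy: "compose (carrier M) f y = y"
    using S.idem_equiv_corner[OF assms] unfolding grEnd_simps by metis
  note e = idempotent_apply[OF assms(2)] and f = idempotent_apply[OF assms(3)]
  note xD = grEndD[OF x] and yD = grEndD[OF y]
  have yf: "y z \<in> f ` carrier M" and xe: "x z \<in> e ` carrier M" if "z \<in> carrier M" for z
    using that xD(3) yD(3) compose_eq[OF that, of f y] compose_eq[OF that, of e x]
    by (auto simp: e(3) f(3) fy ex)
  let ?g = "restrict y (e ` carrier M)"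
  have "bij_betw ?g (e ` carrier M) (f ` carrier M)"
    unfolding bij_betw_restrict_eq
  proof (rule bij_betw_byWitness[where f' = x])
    show "\<forall>z\<in>e ` carrier M. x (y z) = z" "\<forall>z\<in>f ` carrier M. y (x z) = z"
      using xy e(3) f(3) by (metis compose_eq)+
    show "y ` e ` carrier M \<subseteq> f ` carrier M" "x ` f ` carrier M \<subseteq> e ` carrier M"
      using yf xe by (auto simp: grEndD(3)[OF e(1)] grEndD(3)[OF f(1)])
  qed
  moreover have "additive_subgroup (e ` carrier M) M"
    "\<And>z a. \<lbrakk>z \<in> e ` carrier M; a \<in> carrier R\<rbrakk> \<Longrightarrow> z \<star>\<^bsub>M\<^esub> a \<in> e ` carrier M"
    using graded_submodule_image[OF e(1)]
    by (auto simp: graded_submodule_def right_submodule_def)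
  note sub = additive_subgroup.a_closed[OF this(1)] this(2)
  have "?g \<in> Hom_deg G R (M\<lparr>carrier := e ` carrier M\<rparr>) (\<lambda>\<gamma>. e ` carrier M \<inter> Mg \<gamma>)
      (M\<lparr>carrier := f ` carrier M\<rparr>) (\<lambda>\<gamma>. f ` carrier M \<inter> Mg \<gamma>) \<one>\<^bsub>G\<^esub>"
  proof -
    have "?g \<in> Hom_mod R (M\<lparr>carrier := e ` carrier M\<rparr>) (M\<lparr>carrier := f ` carrier M\<rparr>)"
      by (rule Hom_modI) (use sub yf e(3) Hom_modD(2,3)[OF yD(1)] in simp_all)
    then show ?thesis
      using yD(2) yf grEndD(3)[OF e(1)] unfolding Hom_deg_def by auto
  qed
  ultimately show ?thesis
    unfolding graded_isomorphic_sub_def graded_isomorphic_def by (intro bexI[of _ ?g]) simp_all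
qed

text \<open>That \<open>\<phi>\<inverse>\<close> preserves degrees follows from the fact that \<open>\<phi> \<circ> e\<close>, being graded, commutes
  with the projections onto the homogeneous components.\<close>

lemma graded_isomorphic_imp_idem_equiv:
  assumes iso: "graded_isomorphic_sub G R M Mg (e ` carrier M) (f ` carrier M)"
    and "e \<in> idempotents grEnd" "f \<in> idempotents grEnd"
  shows "idem_equiv grEnd e f"
proof -
  note e = idempotent_apply[OF assms(2)] and f = idempotent_apply[OF assms(3)]
  note eD = grEndD[OF e(1)] and fD = grEndD[OF f(1)]
  note eH = Hom_modD[OF eD(1)] and fH = Hom_modD[OF fD(1)]
  let ?B = "e ` carrier M" and ?D = "f ` carrier M"
  obtain \<phi> where \<phi>: "\<phi> \<in> Hom_mod R (M\<lparr>carrier := ?B\<rparr>) (M\<lparr>carrier := ?D\<rparr>)"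
    and deg: "\<And>\<delta>. \<delta> \<in> carrier G \<Longrightarrow> \<phi> ` (?B \<inter> Mg \<delta>) \<subseteq> ?D \<inter> Mg (\<one>\<^bsub>G\<^esub> \<otimes>\<^bsub>G\<^esub> \<delta>)"
    and bij: "bij_betw \<phi> ?B ?D"
    using iso unfolding graded_isomorphic_sub_def graded_isomorphic_def Hom_deg_def by auto
  have \<phi>_closed: "\<phi> z \<in> ?D" if "z \<in> ?B" for z
    using bij that by (auto simp: bij_betw_def)
  have \<phi>_add: "\<phi> (z \<oplus>\<^bsub>M\<^esub> w) = \<phi> z \<oplus>\<^bsub>M\<^esub> \<phi> w" if "z \<in> ?B" "w \<in> ?B" for z w
    using Hom_modD(2)[OF \<phi>] that by simp
  have \<phi>_smult: "\<phi> (z \<star>\<^bsub>M\<^esub> a) = \<phi> z \<star>\<^bsub>M\<^esub> a" if "z \<in> ?B" "a \<in> carrier R" for z a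
    using Hom_modD(3)[OF \<phi>] that by simp
  have \<phi>_inj: "z = w" if "\<phi> z = \<phi> w" "z \<in> ?B" "w \<in> ?B" for z w
    using bij that by (auto simp: bij_betw_def inj_on_def)
  have imB: "e z \<in> ?B" and imD: "f z \<in> ?D" if "z \<in> carrier M" for z
    using that by auto
  have carr: "?B \<subseteq> carrier M" "?D \<subseteq> carrier M"
    using e(3) f(3) by auto
  define \<psi> where "\<psi> = inv_into ?B \<phi>"
  have \<psi>: "\<psi> z \<in> ?B" "\<phi> (\<psi> z) = z" if "z \<in> ?D" for z
    using that bij unfolding \<psi>_def bij_betw_def by (auto intro: inv_into_into f_inv_into_f)
  have \<psi>\<phi>: "\<psi> (\<phi> z) = z" if "z \<in> ?B" for z
    using that bij unfolding \<psi>_def bij_betw_def by auto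
  \<comment> \<open>Composition with the projections \<open>e\<close> and \<open>f\<close> extends
    the isomorphism and its inverse to all of the module, by zero on the complements.\<close>
  define y where "y = (\<lambda>z\<in>carrier M. \<phi> (e z))"
  define x where "x = (\<lambda>z\<in>carrier M. \<psi> (f z))"
  have y: "y \<in> carrier grEnd"
    unfolding grEnd_iff
  proof
    show "y \<in> Hom_mod R M M"
      using \<phi>_closed imB carr
      by (intro Hom_modI) (auto simp: y_def eH rsmult_closed \<phi>_add \<phi>_smult)
    show "\<forall>\<delta>\<in>carrier G. \<forall>z\<in>Mg \<delta>. y z \<in> Mg \<delta>"
      using deg eD(2) imB MD.part_carrier unfolding y_def by fastforce
  qed
  have subB: "\<lbrakk>z \<in> ?B; w \<in> ?B\<rbrakk> \<Longrightarrow> z \<oplus>\<^bsub>M\<^esub> w \<in> ?B"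
    "\<lbrakk>z \<in> ?B; a \<in> carrier R\<rbrakk> \<Longrightarrow> z \<star>\<^bsub>M\<^esub> a \<in> ?B" for z w a
    by (auto simp: e(3) eH rsmult_closed simp del: image_iff)
  have subD: "\<lbrakk>z \<in> ?D; w \<in> ?D\<rbrakk> \<Longrightarrow> z \<oplus>\<^bsub>M\<^esub> w \<in> ?D"
    "\<lbrakk>z \<in> ?D; a \<in> carrier R\<rbrakk> \<Longrightarrow> z \<star>\<^bsub>M\<^esub> a \<in> ?D" for z w a
    by (auto simp: f(3) fH rsmult_closed simp del: image_iff)
  \<comment> \<open>Linearity of the inverse is tested after applying the injective map
    \<phi>.\<close>
  have \<psi>_add: "\<psi> (z \<oplus>\<^bsub>M\<^esub> w) = \<psi> z \<oplus>\<^bsub>M\<^esub> \<psi> w" if "z \<in> ?D" "w \<in> ?D" for z w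
    by (rule \<phi>_inj) (simp_all only: \<phi>_add \<psi> subB subD that)
  have \<psi>_smult: "\<psi> (z \<star>\<^bsub>M\<^esub> a) = \<psi> z \<star>\<^bsub>M\<^esub> a" if "z \<in> ?D" "a \<in> carrier R" for z a
    by (rule \<phi>_inj) (simp_all only: \<phi>_smult \<psi> subB subD that)
  have x: "x \<in> carrier grEnd"
    unfolding grEnd_iff
  proof
    show "x \<in> Hom_mod R M M"
      using \<psi>(1) imD carr
      by (intro Hom_modI) (auto simp: x_def fH rsmult_closed \<psi>_add \<psi>_smult)
    show "\<forall>\<delta>\<in>carrier G. \<forall>z\<in>Mg \<delta>. x z \<in> Mg \<delta>"
    proof (intro ballI)
      fix \<delta> z assume \<delta>: "\<delta> \<in> carrier G" and z: "z \<in> Mg \<delta>"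
      have zM: "z \<in> carrier M"
        using MD.part_carrier \<delta> z .
      define w where "w = \<psi> (f z)"
      have w: "w \<in> ?B" "\<phi> w = f z"
        using \<psi> imD zM by (auto simp: w_def)
      then have wM: "w \<in> carrier M" "e w = w"
        by (auto simp: e(3) simp del: image_iff)
      let ?c = "MD.component \<delta> w"
      have cM: "?c \<in> carrier M"
        using MD.component_carrier wM \<delta> by simp
      have ec: "e ?c = ?c"
        using grEnd_component[OF e(1) \<delta> wM(1)] wM(2) by simp
      \<comment> \<open>\<phi> has the same value at \<open>w\<close> and at its \<delta>-component:
        \<open>y\<close> commutes with components, and \<open>y w = f z\<close> is already
        homogeneous of degree \<delta>. Injectivity then makes \<open>w\<close> homogeneous.\<close>
      have "\<phi> ?c = y ?c"
        using cM ec by (simp add: y_def)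
      also have "\<dots> = MD.component \<delta> (y w)"
        using grEnd_component[OF y \<delta> wM(1)] by simp
      also have "\<dots> = \<phi> w"
        using wM w fD(2)[OF \<delta> z] \<delta> by (simp add: y_def MD.component_part[of \<delta>])
      finally have "?c = w"
        using cM ec w(1) e(3) \<phi>_inj by blast
      then show "x z \<in> Mg \<delta>"
        using MD.component_decomp(1)[OF wM(1) \<delta>] zM by (simp add: x_def w_def)
    qed
  qed
  have fixed: "z \<in> ?B \<Longrightarrow> e z = z" "z \<in> ?D \<Longrightarrow> f z = z" for z
    by (simp_all only: e(3) f(3))
  have mapsto: "\<And>z. z \<in> carrier M \<Longrightarrow> e z \<in> ?B" "\<And>z. z \<in> carrier M \<Longrightarrow> f z \<in> ?D"
    "\<And>z. z \<in> ?B \<Longrightarrow> \<phi> z \<in> carrier M" "\<And>z. z \<in> ?D \<Longrightarrow> \<psi> z \<in> carrier M"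
    using \<phi>_closed \<psi>(1) carr by blast+
  have "compose (carrier M) x y = e"
    by (rule extensionalityI[OF compose_extensional eH(4)])
      (simp only: compose_eq x_def y_def restrict_apply' mapsto fixed \<psi>\<phi> \<phi>_closed)
  moreover have "compose (carrier M) y x = f"
    by (rule extensionalityI[OF compose_extensional fH(4)])
      (simp only: compose_eq x_def y_def restrict_apply' mapsto fixed \<psi>)
  ultimately show ?thesis
    unfolding idem_equiv_def grEnd_simps using x y by blast
qed

theorem IC_gr_iff:
  "IC_gr G R M Mg \<longleftrightarrow>
     (\<forall>e\<in>idempotents grEnd. \<forall>f\<in>idempotents grEnd.
        idem_equiv grEnd e f \<longrightarrow>
        idem_equiv grEnd (\<one>\<^bsub>grEnd\<^esub> \<ominus>\<^bsub>grEnd\<^esub> e) (\<one>\<^bsub>grEnd\<^esub> \<ominus>\<^bsub>grEnd\<^esub> f))"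
    (is "_ \<longleftrightarrow> ?C")
proof
  assume IC: "IC_gr G R M Mg"
  show ?C
  proof (intro ballI impI)
    fix e f assume e: "e \<in> idempotents grEnd" and f: "f \<in> idempotents grEnd"
      and ef: "idem_equiv grEnd e f"
    note c = S.compl_idempotent[OF e] S.compl_idempotent[OF f]
    show "idem_equiv grEnd (\<one>\<^bsub>grEnd\<^esub> \<ominus>\<^bsub>grEnd\<^esub> e) (\<one>\<^bsub>grEnd\<^esub> \<ominus>\<^bsub>grEnd\<^esub> f)"
      using IC[unfolded IC_gr_def, rule_format,
          OF graded_submodule_image graded_submodule_image graded_submodule_image
            graded_submodule_image direct_sum_image_compl[OF e] direct_sum_image_compl[OF f]
            idem_equiv_imp_graded_isomorphic[OF ef e f]]
        idempotent_apply(1) e f c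
      by (intro graded_isomorphic_imp_idem_equiv) auto
  qed
next
  assume C: ?C
  show "IC_gr G R M Mg"
    unfolding IC_gr_def
  proof (intro allI impI)
    fix B B' D D'
    assume sub: "graded_submodule G R M Mg B" "graded_submodule G R M Mg B'"
        "graded_submodule G R M Mg D" "graded_submodule G R M Mg D'"
      and sum: "is_direct_sum2 M B B'" "is_direct_sum2 M D D'"
      and iso: "graded_isomorphic_sub G R M Mg B D"
    obtain e where e: "e \<in> idempotents grEnd" "e ` carrier M = B"
      "(\<one>\<^bsub>grEnd\<^esub> \<ominus>\<^bsub>grEnd\<^esub> e) ` carrier M = B'"
      using direct_sum_projection[OF sub(1,2) sum(1)] .
    obtain f where f: "f \<in> idempotents grEnd" "f ` carrier M = D"
      "(\<one>\<^bsub>grEnd\<^esub> \<ominus>\<^bsub>grEnd\<^esub> f) ` carrier M = D'"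
      using direct_sum_projection[OF sub(3,4) sum(2)] .
    have "idem_equiv grEnd e f"
      using graded_isomorphic_imp_idem_equiv iso e f by blast
    then have "idem_equiv grEnd (\<one>\<^bsub>grEnd\<^esub> \<ominus>\<^bsub>grEnd\<^esub> e) (\<one>\<^bsub>grEnd\<^esub> \<ominus>\<^bsub>grEnd\<^esub> f)"
      using C e f by blast
    then show "graded_isomorphic_sub G R M Mg B' D'"
      using idem_equiv_imp_graded_isomorphic S.compl_idempotent e f by metis
  qed
qed

section \<open>Homogeneous parts of endomorphisms\<close>

text \<open>The degree-\<open>\<gamma>\<close> part of an arbitrary endomorphism \<open>f\<close>: its \<open>\<eta>\<close>-component at \<open>x\<close> is the
  \<open>\<eta>\<close>-component of \<open>f\<close> at the \<open>\<gamma>\<inverse>\<eta>\<close>-component of \<open>x\<close>.\<close>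

definition homogeneous_part :: "('m \<Rightarrow> 'm) \<Rightarrow> 'g \<Rightarrow> 'm \<Rightarrow> 'm" where
  "homogeneous_part f \<gamma> = (\<lambda>x\<in>carrier M. \<Oplus>\<^bsub>M\<^esub>\<delta>\<in>MD.support x.
     MD.component (\<gamma> \<otimes>\<^bsub>G\<^esub> \<delta>) (f (MD.component \<delta> x)))"

lemma homogeneous_part_closed:
  assumes "f \<in> Hom_mod R M M" "\<gamma> \<in> carrier G" "x \<in> carrier M"
  shows "homogeneous_part f \<gamma> x \<in> carrier M"
  using assms Hom_modD(1)[OF assms(1)]
  by (auto simp: homogeneous_part_def intro!: M.finsum_closed MD.component_carrier)

text \<open>The summand at \<delta> has degree \<gamma>\<delta>, and \<gamma>\<delta> = \<eta> has
  exactly one solution \<delta> in a group, so one summand survives. This support-free formula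
  reduces the later identities to comparisons of components.\<close>

lemma component_homogeneous_part:
  assumes f: "f \<in> Hom_mod R M M" and \<gamma>: "\<gamma> \<in> carrier G" and \<eta>: "\<eta> \<in> carrier G"
    and x: "x \<in> carrier M"
  shows "MD.component \<eta> (homogeneous_part f \<gamma> x) =
    MD.component \<eta> (f (MD.component (inv\<^bsub>G\<^esub> \<gamma> \<otimes>\<^bsub>G\<^esub> \<eta>) x))"
proof -
  note fD = Hom_modD[OF f]
  let ?\<delta> = "inv\<^bsub>G\<^esub> \<gamma> \<otimes>\<^bsub>G\<^esub> \<eta>"
  let ?t = "\<lambda>\<delta>. MD.component (\<gamma> \<otimes>\<^bsub>G\<^esub> \<delta>) (f (MD.component \<delta> x))"
  have \<delta>: "?\<delta> \<in> carrier G" "\<gamma> \<otimes>\<^bsub>G\<^esub> ?\<delta> = \<eta>"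
    using \<gamma> \<eta> by (simp_all flip: G.m_assoc)
  have uniq: "\<gamma> \<otimes>\<^bsub>G\<^esub> \<delta> = \<eta> \<longleftrightarrow> \<delta> = ?\<delta>" if "\<delta> \<in> carrier G" for \<delta>
    using G.inv_solve_left[OF that \<gamma> \<eta>] by auto
  have t: "?t \<delta> \<in> carrier M" "?t \<delta> \<in> Mg (\<gamma> \<otimes>\<^bsub>G\<^esub> \<delta>)" if "\<delta> \<in> carrier G" for \<delta>
    using that \<gamma> x fD(1) by (auto intro!: MD.component_carrier MD.component_decomp(1))
  have "MD.component \<eta> (homogeneous_part f \<gamma> x) =
      (\<Oplus>\<^bsub>M\<^esub>\<delta>\<in>MD.support x. MD.component \<eta> (?t \<delta>))"
    unfolding homogeneous_part_def restrict_apply'[OF x]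
    using t \<eta> by (intro MD.component_finsum[OF MD.component_decomp(2)[OF x]]) auto
  \<comment> \<open>The surviving index may lie outside the support of \<open>x\<close>; it can
    still be inserted, because its term is then built from \<open>f\<close> at zero.\<close>
  also have "\<dots> = (\<Oplus>\<^bsub>M\<^esub>\<delta>\<in>insert ?\<delta> (MD.support x). if \<delta> = ?\<delta> then ?t ?\<delta> else \<zero>\<^bsub>M\<^esub>)"
  proof (rule M.add.finprod_mono_neutral_cong_left)
    show "finite (insert ?\<delta> (MD.support x))"
      using MD.component_decomp(2)[OF x] by simp
    fix \<delta> assume "\<delta> \<in> insert ?\<delta> (MD.support x) - MD.support x"
    then have "\<delta> = ?\<delta>" "MD.component ?\<delta> x = \<zero>\<^bsub>M\<^esub>"
      using \<delta> by auto
    then show "(if \<delta> = ?\<delta> then ?t ?\<delta> else \<zero>\<^bsub>M\<^esub>) = \<zero>\<^bsub>M\<^esub>"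
      using \<delta> \<eta> hom_zero[OF f] by (simp add: MD.component_zero)
  next
    fix \<delta> assume "\<delta> \<in> MD.support x"
    then have "\<delta> \<in> carrier G"
      by simp
    then show "MD.component \<eta> (?t \<delta>) = (if \<delta> = ?\<delta> then ?t ?\<delta> else \<zero>\<^bsub>M\<^esub>)"
      using t[of \<delta>] \<gamma> \<eta> uniq[of \<delta>] by (auto simp: MD.component_part[of "\<gamma> \<otimes>\<^bsub>G\<^esub> \<delta>"])
  qed (use t(1)[OF \<delta>(1)] \<delta> in auto)
  also have "\<dots> = ?t ?\<delta>"
    using M.add.finprod_singleton_swap[of ?\<delta> "insert ?\<delta> (MD.support x)" "\<lambda>_. ?t ?\<delta>"]
      MD.component_decomp(2)[OF x] t \<delta>(1) by (auto simp: Pi_def)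
  finally show ?thesis
    using \<delta>(2) by simp
qed

text \<open>Right multiplication by \<delta> is injective on degrees, so the component of degree
  \<gamma>\<delta> of \<open>x a\<close> stems from that of degree \<gamma> of \<open>x\<close>
  alone.\<close>

lemma component_rsmult:
  assumes x: "x \<in> carrier M" and \<gamma>: "\<gamma> \<in> carrier G" and \<delta>: "\<delta> \<in> carrier G" and a: "a \<in> Rg \<delta>"
  shows "MD.component (\<gamma> \<otimes>\<^bsub>G\<^esub> \<delta>) (x \<star>\<^bsub>M\<^esub> a) = MD.component \<gamma> x \<star>\<^bsub>M\<^esub> a"
proof -
  have aR: "a \<in> carrier R"
    using RD.part_carrier \<delta> a .
  show ?thesis
    using x
  proof (induction x rule: MD.homogeneous_induct)
    case zero
    then show ?case
      using aR \<gamma> \<delta> by (simp add: rsmult_l_zero MD.component_zero)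
  next
    case (homogeneous \<eta> x)
    then show ?case
      using rsmult_comp[OF homogeneous(1) \<delta> homogeneous(2) a] \<gamma> \<delta> aR
      by (simp add: MD.component_part[of "\<eta> \<otimes>\<^bsub>G\<^esub> \<delta>"] MD.component_part[of \<eta>] rsmult_l_zero)
  next
    case (add x y)
    then show ?case
      using \<gamma> \<delta> aR by (simp add: rsmult_l_distr rsmult_closed MD.component_add MD.component_carrier)
  qed
qed

text \<open>Additivity and linearity are checked on components. For homogeneous scalars linearity
  rests on \<open>inv \<gamma> (\<xi> \<delta>) = (inv \<gamma> \<xi>) \<delta>\<close>; the
  decomposition of \<open>R\<close> then gives all scalars.\<close>

lemma homogeneous_part_in_Hom_deg:
  assumes f: "f \<in> Hom_mod R M M" and \<gamma>: "\<gamma> \<in> carrier G"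
  shows "homogeneous_part f \<gamma> \<in> Hom_deg G R M Mg M Mg \<gamma>"
proof -
  note fD = Hom_modD[OF f]
  note closed = homogeneous_part_closed[OF f \<gamma>]
  note comp = component_homogeneous_part[OF f \<gamma>]
  have hp_add: "homogeneous_part f \<gamma> (x \<oplus>\<^bsub>M\<^esub> y) = homogeneous_part f \<gamma> x \<oplus>\<^bsub>M\<^esub> homogeneous_part f \<gamma> y"
    if "x \<in> carrier M" "y \<in> carrier M" for x y
  proof (rule MD.component_eqI)
    show "homogeneous_part f \<gamma> (x \<oplus>\<^bsub>M\<^esub> y) \<in> carrier M"
      "homogeneous_part f \<gamma> x \<oplus>\<^bsub>M\<^esub> homogeneous_part f \<gamma> y \<in> carrier M"
      using that closed by auto
    fix \<eta> assume \<eta>: "\<eta> \<in> carrier G"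
    have "inv\<^bsub>G\<^esub> \<gamma> \<otimes>\<^bsub>G\<^esub> \<eta> \<in> carrier G"
      using \<gamma> \<eta> by simp
    then show "MD.component \<eta> (homogeneous_part f \<gamma> (x \<oplus>\<^bsub>M\<^esub> y)) =
        MD.component \<eta> (homogeneous_part f \<gamma> x \<oplus>\<^bsub>M\<^esub> homogeneous_part f \<gamma> y)"
      using that \<eta>
      by (simp add: closed comp fD(1,2) MD.component_add MD.component_carrier)
  qed
  have smult_hom: "homogeneous_part f \<gamma> (x \<star>\<^bsub>M\<^esub> a) = homogeneous_part f \<gamma> x \<star>\<^bsub>M\<^esub> a"
    if x: "x \<in> carrier M" and \<delta>: "\<delta> \<in> carrier G" and a: "a \<in> Rg \<delta>" for x a \<delta>
  proof (rule MD.component_eqI)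
    have aR: "a \<in> carrier R"
      using RD.part_carrier \<delta> a .
    show "homogeneous_part f \<gamma> (x \<star>\<^bsub>M\<^esub> a) \<in> carrier M"
      "homogeneous_part f \<gamma> x \<star>\<^bsub>M\<^esub> a \<in> carrier M"
      using x aR closed rsmult_closed by auto
    fix \<eta> assume \<eta>: "\<eta> \<in> carrier G"
    \<comment> \<open>The degree that a scalar of degree \<delta> moves to \<eta>.\<close>
    define \<xi> where "\<xi> = \<eta> \<otimes>\<^bsub>G\<^esub> inv\<^bsub>G\<^esub> \<delta>"
    have \<xi>: "\<xi> \<in> carrier G" "\<eta> = \<xi> \<otimes>\<^bsub>G\<^esub> \<delta>"
      using \<eta> \<delta> by (simp_all add: \<xi>_def G.m_assoc)
    have "inv\<^bsub>G\<^esub> \<gamma> \<otimes>\<^bsub>G\<^esub> \<eta> = (inv\<^bsub>G\<^esub> \<gamma> \<otimes>\<^bsub>G\<^esub> \<xi>) \<otimes>\<^bsub>G\<^esub> \<delta>"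
      using \<xi> \<gamma> \<delta> by (simp add: G.m_assoc)
    then show "MD.component \<eta> (homogeneous_part f \<gamma> (x \<star>\<^bsub>M\<^esub> a)) =
        MD.component \<eta> (homogeneous_part f \<gamma> x \<star>\<^bsub>M\<^esub> a)"
      using x aR \<eta> \<xi>(1) \<gamma> \<delta> component_rsmult[OF _ _ \<delta> a]
      by (simp add: comp rsmult_closed closed fD(1,3) MD.component_carrier \<xi>(2))
  qed
  have smult: "homogeneous_part f \<gamma> (x \<star>\<^bsub>M\<^esub> a) = homogeneous_part f \<gamma> x \<star>\<^bsub>M\<^esub> a"
    if x: "x \<in> carrier M" and "a \<in> carrier R" for x a
    using that(2)
  proof (induction a rule: RD.homogeneous_induct)
    case zero
    then show ?case
      using smult_hom[OF x G.one_closed RD.part_zero[OF G.one_closed]] .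
  next
    case (homogeneous \<delta> a)
    then show ?case
      using smult_hom x by blast
  next
    case (add a b)
    then show ?case
      using x closed by (simp add: rsmult_r_distr rsmult_closed hp_add)
  qed
  have "homogeneous_part f \<gamma> x \<in> Mg (\<gamma> \<otimes>\<^bsub>G\<^esub> \<delta>)" if \<delta>: "\<delta> \<in> carrier G" and x: "x \<in> Mg \<delta>" for \<delta> x
  proof -
    have xM: "x \<in> carrier M"
      using MD.part_carrier \<delta> x .
    have "MD.support x \<subseteq> {\<delta>}"
      using \<delta> x by (auto simp: MD.component_part[of \<delta>] split: if_splits)
    then have "homogeneous_part f \<gamma> x = (\<Oplus>\<^bsub>M\<^esub>\<xi>\<in>{\<delta>}. MD.component (\<gamma> \<otimes>\<^bsub>G\<^esub> \<xi>) (f (MD.component \<xi> x)))"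
      unfolding homogeneous_part_def restrict_apply'[OF xM] using xM \<delta> \<gamma> fD(1) hom_zero[OF f]
      by (intro M.add.finprod_mono_neutral_cong_left)
        (auto simp: MD.component_carrier MD.component_zero)
    also have "\<dots> = MD.component (\<gamma> \<otimes>\<^bsub>G\<^esub> \<delta>) (f x)"
      using \<delta> x xM \<gamma> fD(1) by (simp add: MD.component_part[of \<delta>] MD.component_carrier)
    finally show ?thesis
      using MD.component_decomp(1) fD(1) xM \<gamma> \<delta> by simp
  qed
  moreover have "homogeneous_part f \<gamma> \<in> Hom_mod R M M"
    using hp_add smult closed by (intro Hom_modI) (auto simp: homogeneous_part_def)
  ultimately show ?thesis
    by (auto simp: Hom_deg_def)
qed

text \<open>A nonzero part of degree \<gamma> needs a degree \<delta> in \<open>x\<close> and a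
  degree \<eta> in the image of that component with \<open>\<gamma> = \<eta> inv \<delta>\<close>,
  and there are finitely many such pairs.\<close>

lemma finite_homogeneous_parts:
  assumes f: "f \<in> Hom_mod R M M" and x: "x \<in> carrier M"
  shows "finite {\<gamma> \<in> carrier G. homogeneous_part f \<gamma> x \<noteq> \<zero>\<^bsub>M\<^esub>}"
proof -
  note fD = Hom_modD[OF f]
  let ?P = "MD.support x"
  let ?Q = "\<Union>\<delta>\<in>?P. MD.support (f (MD.component \<delta> x))"
  have "{\<gamma> \<in> carrier G. homogeneous_part f \<gamma> x \<noteq> \<zero>\<^bsub>M\<^esub>} \<subseteq> (\<lambda>(\<eta>, \<delta>). \<eta> \<otimes>\<^bsub>G\<^esub> inv\<^bsub>G\<^esub> \<delta>) ` (?Q \<times> ?P)"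
  proof
    fix \<gamma> assume "\<gamma> \<in> {\<gamma> \<in> carrier G. homogeneous_part f \<gamma> x \<noteq> \<zero>\<^bsub>M\<^esub>}"
    then have \<gamma>: "\<gamma> \<in> carrier G" "homogeneous_part f \<gamma> x \<noteq> \<zero>\<^bsub>M\<^esub>"
      by auto
    obtain \<eta> where \<eta>: "\<eta> \<in> carrier G" "MD.component \<eta> (homogeneous_part f \<gamma> x) \<noteq> \<zero>\<^bsub>M\<^esub>"
      using MD.component_eqI[OF homogeneous_part_closed[OF f \<gamma>(1) x] M.zero_closed] \<gamma>(2)
      by (auto simp: MD.component_zero)
    define \<delta> where "\<delta> = inv\<^bsub>G\<^esub> \<gamma> \<otimes>\<^bsub>G\<^esub> \<eta>"
    have \<delta>: "\<delta> \<in> carrier G" "\<eta> \<otimes>\<^bsub>G\<^esub> inv\<^bsub>G\<^esub> \<delta> = \<gamma>"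
      using \<gamma>(1) \<eta>(1) by (simp_all add: \<delta>_def G.inv_mult_group flip: G.m_assoc)
    have nz: "MD.component \<eta> (f (MD.component \<delta> x)) \<noteq> \<zero>\<^bsub>M\<^esub>"
      using \<eta> component_homogeneous_part[OF f \<gamma>(1) \<eta>(1) x] by (simp add: \<delta>_def)
    then have "MD.component \<delta> x \<noteq> \<zero>\<^bsub>M\<^esub>"
      using hom_zero[OF f] \<eta>(1) by (auto simp: MD.component_zero)
    with \<delta> \<eta>(1) nz show "\<gamma> \<in> (\<lambda>(\<eta>, \<delta>). \<eta> \<otimes>\<^bsub>G\<^esub> inv\<^bsub>G\<^esub> \<delta>) ` (?Q \<times> ?P)"
      by (intro image_eqI[of _ _ "(\<eta>, \<delta>)"]) auto
  qed
  moreover have "finite (?Q \<times> ?P)"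
    using x fD(1) MD.component_carrier MD.component_decomp(2) by auto
  ultimately show ?thesis
    using finite_subset by blast
qed

text \<open>At a fixed degree \<eta> the substitution \<open>\<delta> = inv \<gamma> \<eta>\<close>
  turns the sum over the degrees of the parts into the sum over the degrees of \<open>x\<close>,
  which is the \<eta>-component of \<open>f x\<close>.\<close>

lemma finsum_homogeneous_parts:
  assumes f: "f \<in> Hom_mod R M M" and x: "x \<in> carrier M"
    and F: "finite F" "F \<subseteq> carrier G" "{\<gamma> \<in> carrier G. homogeneous_part f \<gamma> x \<noteq> \<zero>\<^bsub>M\<^esub>} \<subseteq> F"
  shows "f x = (\<Oplus>\<^bsub>M\<^esub>\<gamma>\<in>F. homogeneous_part f \<gamma> x)"
proof (rule MD.component_eqI)
  note fD = Hom_modD[OF f]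
  note closed = homogeneous_part_closed[OF f _ x]
  have FG: "\<gamma> \<in> F \<Longrightarrow> \<gamma> \<in> carrier G" for \<gamma>
    using F(2) by auto
  show "f x \<in> carrier M" "(\<Oplus>\<^bsub>M\<^esub>\<gamma>\<in>F. homogeneous_part f \<gamma> x) \<in> carrier M"
    using fD(1) x closed FG by (auto intro!: M.finsum_closed)
  fix \<eta> assume \<eta>: "\<eta> \<in> carrier G"
  let ?t = "\<lambda>\<delta>. MD.component \<eta> (f (MD.component \<delta> x))"
  let ?i = "\<lambda>\<gamma>. inv\<^bsub>G\<^esub> \<gamma> \<otimes>\<^bsub>G\<^esub> \<eta>"
  have t: "?t \<delta> \<in> carrier M" if "\<delta> \<in> carrier G" for \<delta>
    using that \<eta> x fD(1) by (simp add: MD.component_carrier)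
  have inj: "inj_on ?i (carrier G)"
    using \<eta> by (auto intro!: inj_onI)
  have fin: "finite (MD.support x)"
    using MD.component_decomp(2)[OF x] .
  have "MD.component \<eta> (\<Oplus>\<^bsub>M\<^esub>\<gamma>\<in>F. homogeneous_part f \<gamma> x) = (\<Oplus>\<^bsub>M\<^esub>\<gamma>\<in>F. ?t (?i \<gamma>))"
    using F(1) FG closed \<eta> x t
    by (subst MD.component_finsum) (auto simp: component_homogeneous_part[OF f] intro!: M.finsum_cong')
  also have "\<dots> = (\<Oplus>\<^bsub>M\<^esub>\<delta>\<in>?i ` F. ?t \<delta>)"
    using t \<eta> F(2) inj by (intro M.finsum_reindex[symmetric]) (auto intro: inj_on_subset)
  also have "\<dots> = (\<Oplus>\<^bsub>M\<^esub>\<delta>\<in>MD.support x. ?t \<delta>)"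
  proof (rule M.add.finprod_mono_neutral_cong)
    show "finite (MD.support x)" "finite (?i ` F)"
      using fin F(1) by auto
    show "?t \<delta> = \<zero>\<^bsub>M\<^esub>" if "\<delta> \<in> ?i ` F - MD.support x" for \<delta>
      using that FG \<eta> hom_zero[OF f] by (auto simp: MD.component_zero)
    show "?t \<delta> = \<zero>\<^bsub>M\<^esub>" if "\<delta> \<in> MD.support x - ?i ` F" for \<delta>
    proof -
      \<comment> \<open>The only degree of a part that corresponds to \<delta>. It lies outside
        \<open>F\<close>, so this part vanishes at \<open>x\<close>.\<close>
      define \<gamma> where "\<gamma> = \<eta> \<otimes>\<^bsub>G\<^esub> inv\<^bsub>G\<^esub> \<delta>"
      have \<delta>: "\<delta> \<in> carrier G"
        using that by simp
      then have \<gamma>: "\<gamma> \<in> carrier G" "?i \<gamma> = \<delta>"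
        using \<eta> by (simp_all add: \<gamma>_def G.inv_mult_group G.m_assoc)
      then have "homogeneous_part f \<gamma> x = \<zero>\<^bsub>M\<^esub>"
        using that F(3) by blast
      then show ?thesis
        using component_homogeneous_part[OF f \<gamma>(1) \<eta> x] \<gamma>(2) \<eta> by (simp add: MD.component_zero)
    qed
  qed (use t FG \<eta> in auto)
  also have "\<dots> = MD.component \<eta> (\<Oplus>\<^bsub>M\<^esub>\<delta>\<in>MD.support x. f (MD.component \<delta> x))"
    using fin fD(1) x \<eta> by (intro MD.component_finsum[symmetric]) (auto simp: MD.component_carrier)
  also have "\<dots> = MD.component \<eta> (f (\<Oplus>\<^bsub>M\<^esub>\<delta>\<in>MD.support x. MD.component \<delta> x))"
    using fin x by (subst hom_finsum[OF f]) (auto simp: MD.component_carrier)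
  finally show "MD.component \<eta> (f x) = MD.component \<eta> (\<Oplus>\<^bsub>M\<^esub>\<gamma>\<in>F. homogeneous_part f \<gamma> x)"
    using MD.component_decomp(3)[OF x] by simp
qed

text \<open>Each generator meets finitely many nonzero parts of \<open>f\<close>. A part whose
  degree is missed by all generators kills them, hence by linearity the whole module, so one finite
  \<open>F\<close> works for every element.\<close>

theorem END_ring_fin_gen:
  assumes "fin_gen_module R M"
  shows "END_ring G R M Mg = End_ring R M"
proof -
  obtain X where X: "finite X" "X \<subseteq> carrier M"
    and gen: "\<And>m. m \<in> carrier M \<Longrightarrow> \<exists>a\<in>X \<rightarrow> carrier R. m = (\<Oplus>\<^bsub>M\<^esub>x\<in>X. x \<star>\<^bsub>M\<^esub> a x)"
    using assms unfolding fin_gen_module_def by blast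
  have "f \<in> HOM_gr G R M Mg M Mg" if f: "f \<in> Hom_mod R M M" for f
  proof -
    define F where "F = (\<Union>x\<in>X. {\<gamma> \<in> carrier G. homogeneous_part f \<gamma> x \<noteq> \<zero>\<^bsub>M\<^esub>})"
    have F: "finite F" "F \<subseteq> carrier G"
      using X finite_homogeneous_parts[OF f] by (auto simp: F_def)
    have part: "homogeneous_part f \<gamma> \<in> Hom_deg G R M Mg M Mg \<gamma>" if "\<gamma> \<in> carrier G" for \<gamma>
      using homogeneous_part_in_Hom_deg[OF f that] .
    have "homogeneous_part f \<gamma> m = \<zero>\<^bsub>M\<^esub>"
      if \<gamma>: "\<gamma> \<in> carrier G" "\<gamma> \<notin> F" and m: "m \<in> carrier M" for \<gamma> m
    proof -
      have h: "homogeneous_part f \<gamma> \<in> Hom_mod R M M"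
        using part[OF \<gamma>(1)] by (simp add: Hom_deg_def)
      have z: "homogeneous_part f \<gamma> x = \<zero>\<^bsub>M\<^esub>" if "x \<in> X" for x
        using that \<gamma> by (auto simp: F_def)
      obtain a where a: "a \<in> X \<rightarrow> carrier R" "m = (\<Oplus>\<^bsub>M\<^esub>x\<in>X. x \<star>\<^bsub>M\<^esub> a x)"
        using gen[OF m] by blast
      have "homogeneous_part f \<gamma> m = (\<Oplus>\<^bsub>M\<^esub>x\<in>X. homogeneous_part f \<gamma> (x \<star>\<^bsub>M\<^esub> a x))"
        unfolding a(2) using X a(1) by (intro hom_finsum[OF h]) (auto intro!: rsmult_closed)
      also have "\<dots> = (\<Oplus>\<^bsub>M\<^esub>x\<in>X. \<zero>\<^bsub>M\<^esub>)"
        using X a(1) z Hom_modD(3)[OF h]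
        by (intro M.finsum_cong') (auto simp: rsmult_l_zero subset_iff Pi_iff)
      finally show ?thesis
        by simp
    qed
    then have "\<forall>m\<in>carrier M. f m = (\<Oplus>\<^bsub>M\<^esub>\<gamma>\<in>F. homogeneous_part f \<gamma> m)"
      using finsum_homogeneous_parts[OF f _ F] by blast
    then show ?thesis
      unfolding HOM_gr_def using f F part by blast
  qed
  then have "HOM_gr G R M Mg M Mg = Hom_mod R M M"
    by (auto simp: HOM_gr_def)
  then show ?thesis
    by (simp add: END_ring_def End_ring_def)
qed

end

theorem proposition3p1:
  fixes G :: "('g, 'k) monoid_scheme"
    and R :: "('r, 'c) ring_scheme" and Rg :: "'g \<Rightarrow> 'r set"
    and A :: "('r, 'm, 'd) right_module_scheme" and Ag :: "'g \<Rightarrow> 'm set"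
  assumes "group G"
    and "graded_ring G R Rg"
    and "graded_right_module G R Rg A Ag"
  shows
    "(let S = END_ring G R A Ag;
          S\<epsilon> = identity_component G S (Hom_deg G R A Ag A Ag)
      in (unit_regular S\<epsilon> \<longleftrightarrow> von_neumann_regular S\<epsilon> \<and> IC_gr G R A Ag) \<and>
         (unit_regular S\<epsilon> \<longleftrightarrow> von_neumann_regular S\<epsilon> \<and>
            (\<forall>e\<in>idempotents S\<epsilon>. \<forall>f\<in>idempotents S\<epsilon>.
               idem_equiv S\<epsilon> e f \<longrightarrow>
               idem_equiv S\<epsilon> (\<one>\<^bsub>S\<epsilon>\<^esub> \<ominus>\<^bsub>S\<epsilon>\<^esub> e) (\<one>\<^bsub>S\<epsilon>\<^esub> \<ominus>\<^bsub>S\<epsilon>\<^esub> f)))) \<and>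
     (fin_gen_module R A \<longrightarrow>
      END_ring G R A Ag = End_ring R A \<and>
      (let S = End_ring R A;
           S\<epsilon> = identity_component G S (Hom_deg G R A Ag A Ag)
       in (unit_regular S\<epsilon> \<longleftrightarrow> von_neumann_regular S\<epsilon> \<and> IC_gr G R A Ag) \<and>
          (unit_regular S\<epsilon> \<longleftrightarrow> von_neumann_regular S\<epsilon> \<and>
             (\<forall>e\<in>idempotents S\<epsilon>. \<forall>f\<in>idempotents S\<epsilon>.
                idem_equiv S\<epsilon> e f \<longrightarrow>
                idem_equiv S\<epsilon> (\<one>\<^bsub>S\<epsilon>\<^esub> \<ominus>\<^bsub>S\<epsilon>\<^esub> e) (\<one>\<^bsub>S\<epsilon>\<^esub> \<ominus>\<^bsub>S\<epsilon>\<^esub> f)))))"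
proof -
  interpret graded_right_module G R Rg A Ag
    by fact
  show ?thesis
    unfolding Let_def identity_component_END_ring
    using END_ring_fin_gen S.unit_regular_iff_compl_equiv IC_gr_iff by metis
qed

end
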